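(* Let $p\ge0$ be an integer, $C=-\frac{p(p+1)}2$, $V=\mathbb C[g_2,g_3,\wp,\wp']/(\wp'^2-4\wp^3+g_2\wp+g_3)$ with $\partial_x\wp=\wp'$, and let $b(\lambda,x)=\sum_{k\ge-1}b_k\lambda^{-k-1}$, $b_{-1}=1$, $b_k\in V$, be the unique such series with $$b\,b_{xx}-\tfrac12b_x^2-2(\lambda-2C\wp)b^2=-2\lambda.$$ Let $S_p(\lambda)$ be the spectral polynomial of $L=\partial_x^2-p(p+1)\wp$ (see context). Then $\sqrt{S_p(\lambda)/\lambda}\;b(\lambda,x)$ is a polynomial in $\lambda$ of degree $p$ with leading coefficient $1$, and a polynomial of degree $p$ in $\wp$. Moreover: for $p=1$: $b=2\sqrt\lambda\,\dfrac{\lambda-\wp}{\sqrt{4\lambda^3-g_2\lambda-g_3}}$; for $p=2$: $b=\dfrac12\sqrt\lambda\,\dfrac{4\lambda^2-12\wp\lambda+36\wp^2-9g_2}{\sqrt{(\lambda^2-3g_2)(4\lambda^3-9g_2\lambda+27g_3)}}$; for $p=3$: $b=\dfrac{4\lambda^3-24\wp\lambda^2+60(3\wp^2-g_2)\lambda-900\wp^3+225g_2\wp+225g_3}{\sqrt{16\lambda^6-504g_2\lambda^4+2376g_3\lambda^3+4185g_2^2\lambda^2-36450g_2g_3\lambda-3375g_2^3+91125g_3^2}}$.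
   Context: $\wp=\wp(x;\tau)$ is the Weierstrass function with invariants $g_2,g_3$ (so $\wp''=6\wp^2-g_2/2$). The spectral polynomial (spectral curve $y^2=S_p(\lambda)$) of the finite-gap operator $L=\partial_x^2-p(p+1)\wp$ is the unique monic polynomial $S_p$ of degree $2p+1$ in $\lambda$ such that $A^2=S_p(L)$ for a differential operator $A$ of order $2p+1$ with leading coefficient $1$ commuting with $L$; e.g. $S_0=\lambda$, $S_1=\lambda^3-\frac{g_2}4\lambda-\frac{g_3}4$, $S_2=(\lambda^2-3g_2)(\lambda^3-\frac94g_2\lambda+\frac{27}4g_3)$. Square roots of polynomials in $\lambda$ are expanded as formal series in $\lambda^{-1}$ with leading coefficient $\lambda^{d/2}$ ($d$ the degree). *)

theory Defs
  imports Complex_Main "HOL-Computational_Algebra.Polynomial" "HOL-Computational_Algebra.Polynomial_FPS"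
begin

text \<open>Free ring R = C[g2][g3][wp][wp'] realised as nested univariate polynomials:
  complex poly = C[g2];  complex poly poly = C[g2,g3];
  complex poly poly poly = C[g2,g3][wp];  R = complex poly poly poly poly = C[g2,g3,wp][wp'].
  The ring V of the paper is R modulo the ideal generated by rel; equality in V is veq.\<close>

unbundle fps_syntax

type_synonym R = "complex poly poly poly poly"

definition cV :: "complex \<Rightarrow> R" where "cV c = [:[:[:[:c:]:]:]:]"
definition g2 :: R where "g2 = [:[:[:[:0, 1:]:]:]:]"
definition g3 :: R where "g3 = [:[:[:0, 1:]:]:]"
definition wp :: R where "wp = [:[:0, 1:]:]"
definition wp' :: R where "wp' = [:0, 1:]"

definition emb1 :: "complex poly poly \<Rightarrow> R" where "emb1 c = [:[:c:]:]"

definition rel :: R where "rel = wp'^2 - 4 * wp^3 + g2 * wp + g3"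

definition veq :: "R \<Rightarrow> R \<Rightarrow> bool" where "veq x y \<longleftrightarrow> rel dvd (x - y)"

text \<open>the derivation d/dx on R: d g2 = d g3 = 0, d wp = wp', d wp' = 6 wp^2 - g2/2
  (it maps the ideal (rel) into itself, hence descends to V)\<close>
definition Dx :: "R \<Rightarrow> R" where
  "Dx f = wp' * map_poly pderiv f + (6 * wp^2 - cV (1/2) * g2) * pderiv f"

text \<open>formal series in mu = 1/lambda with coefficients in R; coefficientwise x-derivative
  and coefficientwise equality in V\<close>
definition fDx :: "R fps \<Rightarrow> R fps" where "fDx b = Abs_fps (\<lambda>n. Dx (b $ n))"
definition fveq :: "R fps \<Rightarrow> R fps \<Rightarrow> bool" where "fveq f g \<longleftrightarrow> (\<forall>n. veq (f $ n) (g $ n))"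

text \<open>Differential operators sum_i a_i d^i with a_i in R, stored as R poly (coefficient of d^i);
  opmul is their (non-commutative) composition via the Leibniz rule.\<close>
definition opmul :: "R poly \<Rightarrow> R poly \<Rightarrow> R poly" where
  "opmul P Q = (\<Sum>i\<le>degree P. \<Sum>k\<le>i.
      smult (of_nat (i choose k) * coeff P i) (monom 1 (i - k) * map_poly (Dx ^^ k) Q))"

definition opeq :: "R poly \<Rightarrow> R poly \<Rightarrow> bool" where
  "opeq P Q \<longleftrightarrow> (\<forall>n. veq (coeff P n) (coeff Q n))"

definition oppow :: "R poly \<Rightarrow> nat \<Rightarrow> R poly" where "oppow L n = (opmul L ^^ n) 1"

definition opeval :: "R poly \<Rightarrow> R poly \<Rightarrow> R poly" where
  "opeval S L = (\<Sum>i\<le>degree S. smult (coeff S i) (oppow L i))"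

definition Lop :: "nat \<Rightarrow> R poly" where
  "Lop p = [: - cV (of_nat (p * (p + 1))) * wp, 0, 1 :]"

definition spectral_poly :: "nat \<Rightarrow> complex poly poly poly \<Rightarrow> bool" where
  "spectral_poly p S \<longleftrightarrow> lead_coeff S = 1 \<and> degree S = 2 * p + 1 \<and>
     (\<exists>A. degree A = 2 * p + 1 \<and> lead_coeff A = 1 \<and>
          opeq (opmul A (Lop p)) (opmul (Lop p) A) \<and>
          opeq (opmul A A) (opeval (map_poly emb1 S) (Lop p)))"

definition Sp :: "nat \<Rightarrow> complex poly poly poly" where
  "Sp p = (THE S. spectral_poly p S)"

text \<open>For a polynomial P in lambda of degree d: sqrt(P) = lambda^(d/2) * rsqrt P (mu),
  where rsqrt P is the series in mu = 1/lambda with square equal to mu^d P(1/mu)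
  and constant term the positive square root of the (constant) leading coefficient.\<close>
definition rsqrt :: "R poly \<Rightarrow> R fps" where
  "rsqrt P = (THE s. s * s = fps_of_poly (reflect_poly P) \<and> (\<exists>c. s $ 0 = cV c \<and> 0 < Re c))"

text \<open>the defining equation of b, multiplied by mu = 1/lambda (lambda = 1/fps_X);
  C = -p(p+1)/2\<close>
definition Cp :: "nat \<Rightarrow> complex" where "Cp p = - of_nat (p * (p + 1)) / 2"

definition b_eq :: "nat \<Rightarrow> R fps \<Rightarrow> bool" where
  "b_eq p b \<longleftrightarrow> veq (b $ 0) 1 \<and>
     fveq (fps_X * (b * fDx (fDx b) - fps_const (cV (1/2)) * (fDx b)^2)
           - 2 * (1 - fps_const (cV (2 * Cp p) * wp) * fps_X) * b^2)
          (- 2)"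

definition lam :: "R poly" where "lam = [:0, 1:]"
definition cst :: "R \<Rightarrow> R poly" where "cst c = [:c:]"

end

theory Submission
  imports Defs "HOL-Library.Product_Plus"
begin

text \<open>
  Reducing an operator modulo the left ideal generated by \<open>L - \<lambda>\<close> writes it as \<open>e + a \<partial>\<close> with
  \<open>a, e \<in> V[\<lambda>]\<close>. A monic operator of order \<open>2p + 1\<close> commutes with \<open>L = \<partial>\<^sup>2 - U\<close> and squares to
  \<open>S(L)\<close> iff \<open>a\<close> is monic of degree \<open>p\<close>, \<open>e = -a\<^sub>x/2\<close>,
  \<open>a\<^sub>x\<^sub>x\<^sub>x = 4(\<lambda> + U) a\<^sub>x + 2 U\<^sub>x a\<close> and \<open>4S = 4(\<lambda> + U) a\<^sup>2 - 2 a a\<^sub>x\<^sub>x + a\<^sub>x\<^sup>2\<close>.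
  For \<open>U = p(p+1)\<wp>\<close> the linear equation acts triangularly on powers of \<open>\<wp>\<close>, with eigenvalue on
  \<open>\<wp>\<^sup>n\<close> proportional to \<open>n(n+1) - p(p+1)\<close>. This vanishes for \<open>n = p\<close>, which produces a solution of
  degree \<open>p\<close> in \<open>\<wp>\<close> and in \<open>\<lambda>\<close>; it is nonzero for \<open>n < p\<close>, which excludes solutions of lower degree
  in \<open>\<lambda>\<close> and makes \<open>a\<close> and \<open>S\<close> unique. The quadratic equation shows that \<open>a \<surd>(\<lambda>/S)\<close> satisfies
  the equation of \<open>b\<close>, whose solution is determined by its leading coefficient.
\<close>

subsection \<open>Derivations and homomorphisms, coefficientwise\<close>

definition fps_map :: "('a \<Rightarrow> 'b) \<Rightarrow> 'a fps \<Rightarrow> 'b fps" where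
  "fps_map h f = Abs_fps (\<lambda>n. h (f $ n))"

lemma fps_map_nth [simp]: "fps_map h f $ n = h (f $ n)"
  by (simp add: fps_map_def)

locale derivation =
  fixes D :: "'a::comm_ring_1 \<Rightarrow> 'a"
  assumes D_add: "D (x + y) = D x + D y"
    and D_mult: "D (x * y) = D x * y + x * D y"
begin

lemma D_0 [simp]: "D 0 = 0"
  using D_add[of 0 0] by simp

lemma D_1 [simp]: "D 1 = 0"
  using D_mult[of 1 1] by simp

lemma D_minus: "D (- x) = - D x"
  using D_add[of x "- x"] by (simp add: add_eq_0_iff)

lemma D_diff: "D (x - y) = D x - D y"
  using D_add[of x "- y"] by (simp add: D_minus)

lemma D_sum: "D (sum f A) = (\<Sum>i\<in>A. D (f i))"
  by (induction A rule: infinite_finite_induct) (simp_all add: D_add)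

lemma D_of_nat [simp]: "D (of_nat n) = 0"
  by (induction n) (simp_all add: D_add)

lemma D_numeral [simp]: "D (numeral n) = 0"
  using D_of_nat[of "numeral n"] by simp

text \<open>D(s s) = 2 s D(s), so a square root of a constant is constant once 2 s can be cancelled.
  The cancellation is assumed because the locale allows zero divisors.\<close>

lemma D_root_eq_0:
  assumes "D (s * s) = 0" "\<And>x. 2 * (s * x) = 0 \<Longrightarrow> x = 0"
  shows "D s = 0"
  using assms(1) by - (rule assms(2), simp add: D_mult mult.commute)

lemma derivation_map_poly: "derivation (map_poly D)"
proof
  show "map_poly D (p + q) = map_poly D p + map_poly D q" for p q
    by (rule poly_eqI) (simp add: coeff_map_poly D_add)
  show "map_poly D (p * q) = map_poly D p * q + p * map_poly D q" for p q
    by (rule poly_eqI) (simp add: coeff_map_poly coeff_mult D_sum D_mult sum.distrib)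
qed

lemma derivation_fps_map: "derivation (fps_map D)"
proof
  show "fps_map D (p + q) = fps_map D p + fps_map D q" for p q
    by (rule fps_ext) (simp add: D_add)
  show "fps_map D (p * q) = fps_map D p * q + p * fps_map D q" for p q
    by (rule fps_ext) (simp add: fps_mult_nth D_sum D_mult sum.distrib)
qed

end

locale rhom =
  fixes h :: "'a::comm_ring_1 \<Rightarrow> 'b::comm_ring_1"
  assumes h_add: "h (x + y) = h x + h y"
    and h_mult: "h (x * y) = h x * h y"
    and h_1 [simp]: "h 1 = 1"
begin

lemma h_0 [simp]: "h 0 = 0"
  using h_add[of 0 0] by simp

lemma h_minus: "h (- x) = - h x"
  using h_add[of x "- x"] by (simp add: add_eq_0_iff)

lemma h_diff: "h (x - y) = h x - h y"
  using h_add[of x "- y"] by (simp add: h_minus)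

lemma h_sum: "h (sum f A) = (\<Sum>i\<in>A. h (f i))"
  by (induction A rule: infinite_finite_induct) (simp_all add: h_add)

lemma h_power: "h (x ^ n) = h x ^ n"
  by (induction n) (simp_all add: h_mult)

lemma h_of_nat [simp]: "h (of_nat n) = of_nat n"
  by (induction n) (simp_all add: h_add)

lemma h_numeral [simp]: "h (numeral n) = numeral n"
  using h_of_nat[of "numeral n"] by simp

lemma rhom_map_poly: "rhom (map_poly h)"
proof
  show "map_poly h (p + q) = map_poly h p + map_poly h q" for p q
    by (rule poly_eqI) (simp add: coeff_map_poly h_add)
  show "map_poly h (p * q) = map_poly h p * map_poly h q" for p q
    by (rule poly_eqI) (simp add: coeff_map_poly coeff_mult h_sum h_mult)
qed simp

lemma map_poly_smult: "map_poly h (smult c p) = smult (h c) (map_poly h p)"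
  by (rule map_poly_smult) (simp_all add: h_mult)

lemma rhom_fps_map: "rhom (fps_map h)"
proof
  show "fps_map h (p + q) = fps_map h p + fps_map h q" for p q
    by (rule fps_ext) (simp add: h_add)
  show "fps_map h (p * q) = fps_map h p * fps_map h q" for p q
    by (rule fps_ext) (simp add: fps_mult_nth h_sum h_mult)
  show "fps_map h 1 = 1"
    by (rule fps_ext) simp
qed

end

subsection \<open>Modules over a ring of differential operators\<close>

context derivation
begin

text \<open>An operator is stored as the polynomial of its coefficients; \<open>dl Q\<close> is \<open>\<partial> \<circ> Q\<close>.\<close>

definition dl :: "'a poly \<Rightarrow> 'a poly" where
  "dl Q = pCons 0 Q + map_poly D Q"

definition opm :: "'a poly \<Rightarrow> 'a poly \<Rightarrow> 'a poly" where
  "opm P Q = (\<Sum>i\<le>degree P. smult (coeff P i) ((dl ^^ i) Q))"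

definition opev :: "'a poly \<Rightarrow> 'a poly \<Rightarrow> 'a poly" where
  "opev S L = (\<Sum>i\<le>degree S. smult (coeff S i) ((opm L ^^ i) 1))"

lemma opm_bound:
  assumes "degree P \<le> n"
  shows "opm P Q = (\<Sum>i\<le>n. smult (coeff P i) ((dl ^^ i) Q))"
  unfolding opm_def
  by (rule sum.mono_neutral_left) (use assms in \<open>auto simp: coeff_eq_0\<close>)

lemma opev_bound:
  assumes "degree S \<le> n"
  shows "opev S L = (\<Sum>i\<le>n. smult (coeff S i) ((opm L ^^ i) 1))"
  unfolding opev_def
  by (rule sum.mono_neutral_left) (use assms in \<open>auto simp: coeff_eq_0\<close>)

lemma dl_add: "dl (P + Q) = dl P + dl Q"
  by (rule poly_eqI) (simp add: dl_def coeff_map_poly D_add coeff_pCons split: nat.split)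

lemma dl_smult: "dl (smult c Q) = smult (D c) Q + smult c (dl Q)"
  by (rule poly_eqI)
    (simp add: dl_def coeff_map_poly D_mult coeff_pCons algebra_simps split: nat.split)

lemma dl_sum: "dl (sum f A) = (\<Sum>i\<in>A. dl (f i))"
  by (induction A rule: infinite_finite_induct) (simp_all add: dl_add, simp_all add: dl_def)

lemma dl_monom_mult: "dl (monom 1 m * P) = monom 1 (Suc m) * P + monom 1 m * map_poly D P"
proof -
  interpret dp: derivation "map_poly D" by (rule derivation_map_poly)
  have "map_poly D (monom 1 m) = 0"
    by (rule poly_eqI) (simp add: coeff_map_poly)
  thus ?thesis
    by (simp add: dl_def dp.D_mult monom_Suc)
qed

text \<open>The iterated Leibniz rule, by Pascal's identity. It identifies \<open>opm\<close>, built
  from repeated \<partial>, with the binomial sum in \<open>opmul\<close>.\<close>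

lemma dl_funpow:
  "(dl ^^ i) Q = (\<Sum>k\<le>i. smult (of_nat (i choose k)) (monom 1 (i - k) * map_poly (D ^^ k) Q))"
proof (induction i)
  case 0
  show ?case by simp
next
  case (Suc i)
  define T where "T m k = monom 1 m * map_poly (D ^^ k) Q" for m k
  have Dk: "(D ^^ k) 0 = 0" for k by (induction k) simp_all
  have step: "dl (T m k) = T (Suc m) k + T m (Suc k)" for m k
    by (simp add: T_def dl_monom_mult map_poly_map_poly Dk)
  have "(dl ^^ Suc i) Q = (\<Sum>k\<le>i. smult (of_nat (i choose k)) (T (Suc i - k) k + T (i - k) (Suc k)))"
    by (simp add: Suc.IH flip: T_def)
      (simp add: dl_sum dl_smult step Suc_diff_le)
  also have "\<dots> = (\<Sum>k\<le>i. smult (of_nat (i choose k)) (T (Suc i - k) k))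
      + (\<Sum>k\<le>i. smult (of_nat (i choose k)) (T (i - k) (Suc k)))"
    by (simp add: smult_add_right sum.distrib)
  also have "(\<Sum>k\<le>i. smult (of_nat (i choose k)) (T (Suc i - k) k))
     = (\<Sum>k\<le>Suc i. smult (of_nat (i choose k)) (T (Suc i - k) k))"
    by (simp add: binomial_eq_0)
  also have "\<dots> = T (Suc i) 0 + (\<Sum>k\<le>i. smult (of_nat (i choose Suc k)) (T (i - k) (Suc k)))"
    by (subst sum.atMost_Suc_shift) simp
  finally have "(dl ^^ Suc i) Q = T (Suc i) 0
      + (\<Sum>k\<le>i. smult (of_nat (i choose Suc k) + of_nat (i choose k)) (T (i - k) (Suc k)))"
    by (simp add: smult_add_left sum.distrib add.assoc)
  also have "\<dots> = (\<Sum>k\<le>Suc i. smult (of_nat (Suc i choose k)) (T (Suc i - k) k))"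
    by (subst sum.atMost_Suc_shift) (simp add: add.commute)
  finally show ?case by (simp add: T_def)
qed

end

text \<open>\<open>N\<close> is a connection, the action of \<partial>. \<open>act\<close> extends
  it to all operators, and \<open>act_opm\<close> makes the module a left module over the ring of
  operators.\<close>

locale diff_module = derivation D + module scale
  for D :: "'a::comm_ring_1 \<Rightarrow> 'a" and scale :: "'a \<Rightarrow> 'm::ab_group_add \<Rightarrow> 'm" +
  fixes N :: "'m \<Rightarrow> 'm"
  assumes N_add: "N (x + y) = N x + N y"
    and N_scale: "N (scale c x) = scale (D c) x + scale c (N x)"
begin

definition act :: "'a poly \<Rightarrow> 'm \<Rightarrow> 'm" where
  "act P w = (\<Sum>i\<le>degree P. scale (coeff P i) ((N ^^ i) w))"

lemma N_0: "N 0 = 0"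
  using N_add[of 0 0] by simp

lemma act_bound:
  assumes "degree P \<le> n"
  shows "act P w = (\<Sum>i\<le>n. scale (coeff P i) ((N ^^ i) w))"
  unfolding act_def
  by (rule sum.mono_neutral_left) (use assms in \<open>auto simp: coeff_eq_0\<close>)

lemma act_0 [simp]: "act 0 w = 0"
  by (simp add: act_def)

lemma act_add: "act (P + Q) w = act P w + act Q w"
proof -
  define n where "n = max (degree P) (degree Q)"
  have "degree (P + Q) \<le> n" "degree P \<le> n" "degree Q \<le> n"
    by (simp_all add: n_def degree_add_le)
  thus ?thesis by (simp add: act_bound scale_left_distrib sum.distrib)
qed

lemma act_smult: "act (smult c P) w = scale c (act P w)"
proof -
  have "degree (smult c P) \<le> degree P" by (rule degree_smult_le)
  thus ?thesis by (simp add: act_bound[of _ "degree P"] scale_sum_right)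
qed

lemma act_sum: "act (sum f A) w = (\<Sum>i\<in>A. act (f i) w)"
  by (induction A rule: infinite_finite_induct) (simp_all add: act_add)

lemma act_pCons: "act (pCons c P) w = scale c w + act P (N w)"
proof -
  have "act (pCons c P) w
      = (\<Sum>i\<le>Suc (degree P). scale (coeff (pCons c P) i) ((N ^^ i) w))"
    by (rule act_bound) (rule degree_pCons_le)
  also have "\<dots> = scale c w + act P (N w)"
    by (subst sum.atMost_Suc_shift)
      (simp add: act_def funpow_Suc_right del: funpow.simps)
  finally show ?thesis .
qed

lemma act_minus: "act (- P) w = - act P w"
  using act_add[of P "- P" w] by (simp add: add_eq_0_iff)

lemma act_diff: "act (P - Q) w = act P w - act Q w"
  using act_add[of P "- Q" w] by (simp add: act_minus)

lemma act_dl: "act (dl Q) w = N (act Q w)"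
proof (induction Q arbitrary: w)
  case 0
  show ?case by (simp add: dl_def N_0)
next
  case (pCons c Q)
  \<comment> \<open>The operator stored as \<open>pCons c Q\<close> is c + Q \<partial>, and
    \<partial> (c + Q \<partial>) = D c + c \<partial> + (\<partial> Q) \<partial>.\<close>
  have "dl (pCons c Q) = [:D c, c:] + pCons 0 (dl Q)"
    by (rule poly_eqI) (simp add: dl_def coeff_map_poly coeff_pCons split: nat.split)
  thus ?case
    by (simp add: act_add act_pCons pCons.IH N_add N_scale)
qed

lemma act_opm: "act (opm P Q) w = act P (act Q w)"
proof -
  have "act ((dl ^^ i) Q) w = (N ^^ i) (act Q w)" for i
    by (induction i) (simp_all add: act_dl)
  thus ?thesis
    by (simp add: opm_def act_sum act_smult) (simp add: act_def)
qed

text \<open>An endomorphism of the connection passes each coefficient and each \<partial> in turn.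
  Needed for multiplication by constants (\<open>act_pm\<close>) and for the evaluation map in
  \<open>act_residue\<close>.\<close>

lemma act_hom:
  assumes add: "\<And>x y. f (x + y) = f x + f y"
    and scale: "\<And>c x. f (scale c x) = scale c (f x)"
    and N: "\<And>x. f (N x) = N (f x)"
  shows "f (act P x) = act P (f x)"
proof (induction P arbitrary: x)
  case 0
  show ?case using scale[of 0 0] by simp
next
  case (pCons c P)
  thus ?case by (simp add: act_pCons add scale N)
qed

end

subsection \<open>Commuting operators and the module of pairs\<close>

locale schroedinger = derivation D for D :: "'a::idom \<Rightarrow> 'a" +
  fixes U h :: 'a
  assumes half: "2 * h = 1"
begin

abbreviation d :: "'a poly \<Rightarrow> 'a poly" where "d \<equiv> map_poly D"

sublocale dp: derivation d
  by (rule derivation_map_poly)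

definition L :: "'a poly" where "L = [:- U, 0, 1:]"

definition psc :: "'a \<Rightarrow> 'a poly \<times> 'a poly \<Rightarrow> 'a poly \<times> 'a poly" where
  "psc c w = (smult c (fst w), smult c (snd w))"

definition pm :: "'a poly \<Rightarrow> 'a poly \<times> 'a poly \<Rightarrow> 'a poly \<times> 'a poly" where
  "pm x w = (x * fst w, x * snd w)"

text \<open>A pair \<open>(e, a)\<close> stands for the residue class of \<open>e + a \<partial>\<close> modulo the left ideal generated by
  \<open>L - \<lambda>\<close>; left composition with \<open>\<partial>\<close> uses \<open>\<partial>\<^sup>2 = \<lambda> + U\<close>.\<close>

definition nab :: "'a poly \<times> 'a poly \<Rightarrow> 'a poly \<times> 'a poly" where
  "nab w = (d (fst w) + [:U, 1:] * snd w, fst w + d (snd w))"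

abbreviation cyc :: "'a poly \<times> 'a poly" where "cyc \<equiv> (1, 0)"

sublocale M: diff_module D psc nab
proof
  show "psc a (x + y) = psc a x + psc a y" for a x y
    by (simp add: psc_def smult_add_right)
  show "psc (a + b) x = psc a x + psc b x" for a b x
    by (simp add: psc_def smult_add_left)
  show "psc a (psc b x) = psc (a * b) x" "psc 1 x = x" for a b x
    by (simp_all add: psc_def)
  show "nab (x + y) = nab x + nab y" for x y
    by (simp add: nab_def dp.D_add distrib_left)
  have "d (smult c q) = smult (D c) q + smult c (d q)" for c q
    by (rule poly_eqI) (simp add: coeff_map_poly D_mult)
  thus "nab (psc c x) = psc (D c) x + psc c (nab x)" for c x
    by (simp add: nab_def psc_def smult_add_right)
qed

lemma pm_add: "pm x (v + w) = pm x v + pm x w" "pm (x + y) v = pm x v + pm y v"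
  by (simp_all add: pm_def algebra_simps)

lemma pm_pm: "pm x (pm y v) = pm (x * y) v"
  by (simp add: pm_def mult.assoc)

lemma psc_eq_pm: "psc c w = pm [:c:] w"
  by (simp add: psc_def pm_def)

lemma nab_pm: "nab (pm x w) = pm (d x) w + pm x (nab w)"
  by (simp add: nab_def pm_def dp.D_mult algebra_simps)

abbreviation lm :: "'a poly \<times> 'a poly \<Rightarrow> 'a poly \<times> 'a poly" where "lm \<equiv> pm [:0, 1:]"

lemma d_pCons [simp]: "d (pCons c q) = pCons (D c) (d q)"
  by (simp add: map_poly_pCons)

lemma act_pm: "d x = 0 \<Longrightarrow> M.act P (pm x w) = pm x (M.act P w)"
  by (rule M.act_hom[symmetric]) (simp_all add: pm_add nab_pm psc_eq_pm pm_pm mult.commute,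
      simp add: pm_def zero_prod_def)

lemma act_lm: "M.act P (lm w) = lm (M.act P w)"
  by (rule act_pm) simp

lemma act_L: "M.act L w = nab (nab w) - psc U w"
  by (simp add: L_def M.act_pCons M.scale_minus_left)

text \<open>The two components are the coefficients of 1 and of \<partial> in the class of (L -
  \<lambda>)(e + a \<partial>). Composing with L on the right acts as \<lambda>
  (\<open>act_opm_L\<close>), so their vanishing says that an operator with class (e, a) commutes
  with L.\<close>

lemma act_L_eq_lm_iff:
  "M.act L (e, a) = lm (e, a) \<longleftrightarrow>
     d (d e) + 2 * ([:U, 1:] * d a) + [:D U:] * a = 0 \<and> 2 * d e + d (d a) = 0"
proof -
  have X: "[:U, 1:] = [:U:] + [:0, 1:]" and dX: "d [:U, 1:] = [:D U:]" by simp_all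
  have "M.act L (e, a) - lm (e, a)
      = (d (d e) + 2 * ([:U, 1:] * d a) + [:D U:] * a, 2 * d e + d (d a))"
    unfolding act_L nab_def psc_eq_pm pm_def fst_conv snd_conv dp.D_add dp.D_mult dX
    unfolding X by (simp add: algebra_simps del: mult_pCons_left mult_pCons_right add_pCons)
  moreover have "M.act L (e, a) = lm (e, a) \<longleftrightarrow> M.act L (e, a) - lm (e, a) = 0"
    by (rule right_minus_eq[symmetric])
  ultimately show ?thesis by (simp only: zero_prod_def prod.inject)
qed

text \<open>L - \<lambda> kills \<open>cyc\<close>, the class of 1, and multiplication by \<lambda>
  commutes with every operator.\<close>

lemma act_opm_L: "M.act (opm P L) cyc = lm (M.act P cyc)"
proof -
  have "M.act L cyc = lm cyc"
    by (subst act_L_eq_lm_iff) simp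
  thus ?thesis by (simp add: M.act_opm act_lm)
qed

lemma act_opev: "M.act (opev S L) cyc = (S, 0)"
proof -
  have "M.act ((opm L ^^ i) 1) cyc = (monom 1 i, 0)" for i
  proof (induction i)
    case 0
    have "M.act 1 cyc = cyc"
      by (simp only: one_pCons M.act_pCons) simp
    thus ?case by simp
  next
    case (Suc i)
    have "M.act L cyc = lm cyc"
      by (subst act_L_eq_lm_iff) simp
    moreover have "(monom 1 i, 0) = pm (monom 1 i) cyc" by (simp add: pm_def)
    moreover have "d (monom 1 i) = 0" by (simp add: map_poly_monom)
    ultimately have "M.act L (monom 1 i, 0) = pm (monom 1 i) (lm cyc)"
      by (simp only: act_pm)
    thus ?case
      by (simp add: M.act_opm Suc.IH) (simp add: pm_def monom_Suc)
  qed
  hence "M.act (opev S L) cyc = (\<Sum>i\<le>degree S. (monom (coeff S i) i, 0))"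
    by (simp add: opev_def M.act_sum M.act_smult psc_def smult_monom)
  also have "\<dots> = (\<Sum>i\<le>degree S. monom (coeff S i) i, 0)"
    by (simp add: prod_eq_iff fst_sum snd_sum)
  finally show ?thesis by (simp add: poly_as_sum_of_monoms)
qed

text \<open>The module is generated by \<open>cyc\<close> with the relation L = \<lambda>, so an
  eigenvector w of L for \<lambda> is the image of \<open>cyc\<close> under a module map
  \<open>f\<close>. With w the class of A, this evaluates the class of A A.\<close>

lemma act_residue:
  assumes "M.act L w = lm w"
  shows "M.act P w = pm (fst (M.act P cyc)) w + pm (snd (M.act P cyc)) (nab w)"
proof -
  define f where "f v = pm (fst v) w + pm (snd v) (nab w)" for v
  have nn: "nab (nab w) = pm [:U, 1:] w"
  proof -
    have "nab (nab w) = lm w + pm [:U:] w"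
      using assms by (simp add: act_L psc_eq_pm algebra_simps)
    thus ?thesis by (simp flip: pm_add)
  qed
  have "f (M.act P cyc) = M.act P (f cyc)"
  proof (rule M.act_hom)
    show "f (x + y) = f x + f y" for x y
      by (simp add: f_def pm_add)
    show "f (psc c x) = psc c (f x)" for c x
      by (simp add: f_def psc_def pm_def smult_add_right)
    show "f (nab x) = nab (f x)" for x
      unfolding f_def M.N_add nab_pm nn pm_pm
      by (simp add: nab_def[of x] pm_add algebra_simps)
  qed
  moreover have "f cyc = w" by (simp add: f_def pm_def zero_prod_def)
  ultimately show ?thesis by (simp add: f_def)
qed

text \<open>Replacing \<open>\<partial>^2\<close> by \<lambda> + U turns
  \<open>\<partial>^(2j)\<close> into \<open>\<lambda>^j\<close> and
  \<open>\<partial>^(2j+1)\<close> into \<open>\<lambda>^j \<partial>\<close>, up to terms of lower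
  order when \<lambda> counts as order 2.\<close>

lemma nab_funpow_coeff:
  "(2 * j > i \<longrightarrow> coeff (fst ((nab ^^ i) cyc)) j = 0) \<and>
   (2 * j + 1 > i \<longrightarrow> coeff (snd ((nab ^^ i) cyc)) j = 0) \<and>
   (i = 2 * j \<longrightarrow> coeff (fst ((nab ^^ i) cyc)) j = 1) \<and>
   (i = 2 * j + 1 \<longrightarrow> coeff (snd ((nab ^^ i) cyc)) j = 1)"
proof (induction i arbitrary: j)
  case 0
  show ?case by (auto simp: coeff_eq_0)
next
  case (Suc i)
  define w where "w = (nab ^^ i) cyc"
  have IH: "2 * j > i \<Longrightarrow> coeff (fst w) j = 0" "2 * j + 1 > i \<Longrightarrow> coeff (snd w) j = 0"
    "i = 2 * j \<Longrightarrow> coeff (fst w) j = 1" "i = 2 * j + 1 \<Longrightarrow> coeff (snd w) j = 1" for j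
    using Suc.IH[of j] by (simp_all add: w_def)
  have E: "coeff (fst (nab w)) j
      = D (coeff (fst w) j) + U * coeff (snd w) j + (case j of 0 \<Rightarrow> 0 | Suc k \<Rightarrow> coeff (snd w) k)"
    by (simp add: nab_def coeff_map_poly coeff_pCons split: nat.split)
  have A: "coeff (snd (nab w)) j = coeff (fst w) j + D (coeff (snd w) j)"
    by (simp add: nab_def coeff_map_poly)
  show ?case
    unfolding funpow.simps o_apply w_def[symmetric] E A
    by (auto simp: IH split: nat.split)
qed

text \<open>The order and leading coefficient of P can be read off its class, from the first
  component for even order and from the second for odd order. This yields
  \<open>act_inj\<close>.\<close>

lemma act_coeff:
  assumes "degree P \<le> n"
  shows "n < 2 * j \<Longrightarrow> coeff (fst (M.act P cyc)) j = 0"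
    and "n < 2 * j + 1 \<Longrightarrow> coeff (snd (M.act P cyc)) j = 0"
    and "n = 2 * j \<Longrightarrow> coeff (fst (M.act P cyc)) j = coeff P n"
    and "n = 2 * j + 1 \<Longrightarrow> coeff (snd (M.act P cyc)) j = coeff P n"
proof -
  have *: "M.act P cyc = (\<Sum>i\<le>n. psc (coeff P i) ((nab ^^ i) cyc))"
    by (rule M.act_bound) (rule assms)
  have f: "coeff (fst (M.act P cyc)) j = (\<Sum>i\<le>n. coeff P i * coeff (fst ((nab ^^ i) cyc)) j)"
   and s: "coeff (snd (M.act P cyc)) j = (\<Sum>i\<le>n. coeff P i * coeff (snd ((nab ^^ i) cyc)) j)"
    unfolding * by (simp_all add: fst_sum snd_sum coeff_sum psc_def)
  show "n < 2 * j \<Longrightarrow> coeff (fst (M.act P cyc)) j = 0"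
    "n < 2 * j + 1 \<Longrightarrow> coeff (snd (M.act P cyc)) j = 0"
    unfolding f s using nab_funpow_coeff by (auto intro!: sum.neutral)
  have split: "(\<Sum>i\<le>n. g i) = g n" if "\<And>i. i < n \<Longrightarrow> g i = 0" for g :: "nat \<Rightarrow> 'a"
    using that by (subst sum.remove[of _ n]) (auto intro!: sum.neutral)
  show "coeff (fst (M.act P cyc)) j = coeff P n" if "n = 2 * j"
    unfolding f by (subst split) (use that nab_funpow_coeff in auto)
  show "coeff (snd (M.act P cyc)) j = coeff P n" if "n = 2 * j + 1"
    unfolding s by (subst split) (use that nab_funpow_coeff in auto)
qed

lemma act_inj:
  assumes "M.act P cyc = M.act Q cyc"
  shows "P = Q"
proof -
  define R where "R = P - Q"
  have 0: "M.act R cyc = 0" using assms by (simp add: R_def M.act_diff)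
  have "coeff R (degree R) = 0"
  proof (cases "even (degree R)")
    case True
    then obtain j where "degree R = 2 * j" by (elim evenE)
    thus ?thesis using act_coeff(3)[of R "degree R" j] by (simp add: 0)
  next
    case False
    then obtain j where "degree R = 2 * j + 1" by (elim oddE)
    thus ?thesis using act_coeff(4)[of R "degree R" j] by (simp add: 0)
  qed
  hence "R = 0" by (simp only: leading_coeff_0_iff)
  thus ?thesis by (simp add: R_def)
qed

text \<open>The classes of 1 and \<partial> are attained, and powers of \<lambda> are supplied by
  composing with L on the right.\<close>

lemma act_surj: "\<exists>P. M.act P cyc = v"
proof -
  have step: "\<exists>P. M.act P cyc = pm q w" if w: "\<exists>P. M.act P cyc = w" for q w
  proof (induction q)
    case 0
    show ?case by (rule exI[of _ 0]) (simp add: pm_def zero_prod_def)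
  next
    case (pCons c q)
    from w obtain P where P: "M.act P cyc = w" by blast
    from pCons obtain Q where Q: "M.act Q cyc = pm q w" by blast
    have "pCons c q = [:c:] + [:0, 1:] * q" by simp
    hence "M.act (smult c P + opm Q L) cyc = pm (pCons c q) w"
      by (simp add: M.act_add M.act_smult act_opm_L P Q psc_eq_pm pm_pm pm_add)
        (simp add: pm_def algebra_simps)
    thus ?case by blast
  qed
  have "M.act 1 cyc = cyc" "M.act [:0, 1:] cyc = (0, 1)"
    by (simp_all only: one_pCons M.act_pCons) (simp_all add: nab_def psc_def one_pCons)
  then obtain P Q where "M.act P cyc = pm (fst v) cyc" "M.act Q cyc = pm (snd v) (0, 1)"
    using step by meson
  hence "M.act (P + Q) cyc = v" by (simp add: M.act_add pm_def)
  thus ?thesis by blast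
qed

lemma two_cancel: "2 * x = 2 * y \<longleftrightarrow> x = y" for x y :: "'a poly"
proof -
  have "(2::'a) \<noteq> 0" using half by auto
  hence "(2::'a poly) \<noteq> 0" by (simp add: numeral_poly)
  thus ?thesis by simp
qed

lemma four_cancel: "4 * x = 4 * y \<longleftrightarrow> x = y" for x y :: "'a poly"
proof -
  have "4 * z = 2 * (2 * z)" for z :: "'a poly" by simp
  thus ?thesis by (simp only: two_cancel)
qed

text \<open>The operator with residue class \<open>(-a\<^sub>x/2, a)\<close> squares to \<open>S(L)\<close>; commutation is the
  symmetric square of \<open>\<psi>\<^sub>x\<^sub>x = (\<lambda> + U) \<psi>\<close> for \<open>a\<close>.\<close>

theorem commuting_root_iff:
  "(\<exists>A. degree A = 2 * p + 1 \<and> lead_coeff A = 1 \<and> opm A L = opm L A \<and> opm A A = opev S L) \<longleftrightarrow>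
   (\<exists>a. degree a = p \<and> lead_coeff a = 1 \<and>
      d (d (d a)) = 4 * [:U, 1:] * d a + 2 * [:D U:] * a \<and>
      4 * S = 4 * [:U, 1:] * a^2 - 2 * a * d (d a) + (d a)^2)" (is "?lhs \<longleftrightarrow> ?rhs")
proof
  assume ?lhs
  then obtain A where A: "degree A = 2 * p + 1" "lead_coeff A = 1" "opm A L = opm L A"
    "opm A A = opev S L" by blast
  define e a where "e = fst (M.act A cyc)" and "a = snd (M.act A cyc)"
  have ea: "M.act A cyc = (e, a)" by (simp add: e_def a_def)
  have ap: "coeff a p = 1"
    using act_coeff(4)[of A "2 * p + 1" p] A by (simp add: a_def)
  have "coeff a j = 0" if "j > p" for j
    using act_coeff(2)[of A "2 * p + 1" j] A that by (simp add: a_def)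
  hence "degree a \<le> p" by (simp add: degree_le)
  hence deg: "degree a = p" using ap le_degree[of a p] by force
  have "a \<noteq> 0" using ap by auto
  have w: "M.act L (e, a) = lm (e, a)"
    using act_opm_L[of A] A(3) by (simp add: M.act_opm ea)
  hence lin: "d (d e) + 2 * ([:U, 1:] * d a) + [:D U:] * a = 0"
    by (simp add: act_L_eq_lm_iff)
  have "(S, 0) = M.act (opm A A) cyc" by (simp add: A(4) act_opev)
  also have "\<dots> = pm e (e, a) + pm a (nab (e, a))"
    using act_residue[OF w, of A] by (simp add: M.act_opm ea)
  finally have S: "S = e * e + a * (d e + [:U, 1:] * a)" and "0 = e * a + a * (e + d a)"
    by (simp_all add: pm_def nab_def)
  \<comment> \<open>The second component of the class of A A must vanish. Without zero divisors this
    fixes e = -a_x/2.\<close>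
  hence "a * (2 * e + d a) = 0" by (simp add: algebra_simps)
  hence "2 * e + d a = 0" using \<open>a \<noteq> 0\<close> by simp
  hence da: "d a = - 2 * e" by (simp only: add_eq_0_iff mult_minus_left)
  have dm: "d (- 2 * x) = - 2 * d x" for x
    by (simp add: dp.D_minus dp.D_mult)
  show ?rhs
  proof (intro exI conjI)
    show "degree a = p" "lead_coeff a = 1" using deg ap by simp_all
    show "d (d (d a)) = 4 * [:U, 1:] * d a + 2 * [:D U:] * a"
      using lin unfolding da dm by algebra
    show "4 * S = 4 * [:U, 1:] * a^2 - 2 * a * d (d a) + (d a)^2"
      unfolding da dm S by algebra
  qed
next
  assume ?rhs
  then obtain a where a: "degree a = p" "lead_coeff a = 1"
    "d (d (d a)) = 4 * [:U, 1:] * d a + 2 * [:D U:] * a"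
    "4 * S = 4 * [:U, 1:] * a^2 - 2 * a * d (d a) + (d a)^2" by blast
  define e where "e = - ([:h:] * d a)"
  have h2: "2 * [:h:] = 1"
    using half by (simp add: numeral_poly one_pCons mult.commute)
  have de: "2 * e = - d a"
    using h2 unfolding e_def by algebra
  have dde: "2 * d e = - d (d a)"
    using arg_cong[OF de, of d] by (simp add: dp.D_mult dp.D_minus)
  have ddde: "2 * d (d e) = - d (d (d a))"
    using arg_cong[OF dde, of d] by (simp add: dp.D_mult dp.D_minus)
  obtain A where A: "M.act A cyc = (e, a)" using act_surj by blast
  \<comment> \<open>The leading coefficient 1 has derivative 0, so a_x and hence e have degree below
    p in \<lambda>. This serves to exclude an even order of A.\<close>
  have "coeff (d a) j = 0" if "j \<ge> p" for j
    using that a by (cases "j = p") (simp_all add: coeff_map_poly coeff_eq_0)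
  hence e0: "coeff e j = 0" if "j \<ge> p" for j
    using that by (simp add: e_def)
  have a0: "coeff a j = 0" if "j > p" for j using a that by (simp add: coeff_eq_0)
  have ap: "coeff a p = 1" using a by simp
  have w: "M.act L (e, a) = lm (e, a)"
  proof (subst act_L_eq_lm_iff, intro conjI)
    have "2 * (d (d e) + 2 * ([:U, 1:] * d a) + [:D U:] * a) = 2 * 0"
      using ddde a(3) by algebra
    thus "d (d e) + 2 * ([:U, 1:] * d a) + [:D U:] * a = 0" by (simp only: two_cancel)
    show "2 * d e + d (d a) = 0" by (simp add: dde)
  qed
  have "A \<noteq> 0" using A ap by (auto simp: zero_prod_def)
  have "degree A = 2 * p + 1"
  proof (cases "even (degree A)")
    case True
    then obtain j where j: "degree A = 2 * j" by (elim evenE)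
    hence "coeff e j = lead_coeff A" using act_coeff(3)[of A "degree A" j] by (simp add: A)
    hence "j < p" using e0[of j] \<open>A \<noteq> 0\<close> by (metis leading_coeff_0_iff not_le_imp_less)
    hence "coeff a p = 0" using act_coeff(2)[of A "degree A" p] j by (simp add: A)
    thus ?thesis using ap by simp
  next
    case False
    then obtain j where j: "degree A = 2 * j + 1" by (elim oddE)
    hence "coeff a j = lead_coeff A" using act_coeff(4)[of A "degree A" j] by (simp add: A)
    hence "j \<le> p" using a0[of j] \<open>A \<noteq> 0\<close> by (metis leading_coeff_0_iff not_le_imp_less)
    moreover have "\<not> j < p" using act_coeff(2)[of A "degree A" p] j ap by (auto simp: A)
    ultimately show ?thesis using j by simp
  qed
  moreover from this have "lead_coeff A = 1"
    using act_coeff(4)[of A "degree A" p] ap by (simp add: A)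
  moreover have "opm A L = opm L A"
    by (rule act_inj) (simp only: act_opm_L M.act_opm[of L] A w)
  moreover have "opm A A = opev S L"
  proof (rule act_inj)
    have da: "d a = - 2 * e"
      using de by (simp only: mult_minus_left minus_minus)
    have dm: "d (- 2 * x) = - 2 * d x" for x
      by (simp add: dp.D_minus dp.D_mult)
    have "4 * S = 4 * (e * e + a * (d e + [:U, 1:] * a))"
      unfolding a(4) da dm by algebra
    hence "e * e + a * (d e + [:U, 1:] * a) = S" by (simp only: four_cancel)
    moreover have "e * a + a * (e + d a) = 0"
      unfolding da by algebra
    moreover have "M.act (opm A A) cyc = pm e (e, a) + pm a (nab (e, a))"
      using act_residue[OF w, of A] by (simp only: M.act_opm A fst_conv snd_conv)
    ultimately show "M.act (opm A A) cyc = M.act (opev S L) cyc"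
      by (simp only: act_opev pm_def nab_def fst_conv snd_conv add_Pair)
  qed
  ultimately show ?lhs by blast
qed

end

subsection \<open>The quadratic equation for formal series\<close>

text \<open>\<open>rv n q\<close> is \<open>\<mu>\<^sup>n q(1/\<mu>)\<close>.\<close>

definition rv :: "nat \<Rightarrow> 'a::zero poly \<Rightarrow> 'a fps" where
  "rv n q = Abs_fps (\<lambda>i. if i \<le> n then coeff q (n - i) else 0)"

lemma rv_nth: "rv n q $ i = (if i \<le> n then coeff q (n - i) else 0)"
  by (simp add: rv_def)

lemma rv_0 [simp]: "rv n 0 = 0"
  by (rule fps_ext) (simp add: rv_nth)

lemma rv_add: "rv n (p + q) = rv n p + rv n q"
  by (rule fps_ext) (simp add: rv_nth)

lemma rv_reflect:
  assumes "degree q \<le> n"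
  shows "rv n q = fps_X ^ (n - degree q) * fps_of_poly (reflect_poly (q :: 'a::comm_ring_1 poly))"
  by (rule fps_ext)
    (use assms in \<open>auto simp: rv_nth fps_X_power_mult_nth coeff_reflect_poly coeff_eq_0\<close>)

lemma rv_mult:
  fixes q r :: "'a::idom poly"
  assumes "degree q \<le> n" "degree r \<le> m"
  shows "rv (n + m) (q * r) = rv n q * rv m r"
proof (cases "q = 0 \<or> r = 0")
  case True
  thus ?thesis by auto
next
  case False
  hence deg: "degree (q * r) = degree q + degree r" by (simp add: degree_mult_eq)
  have "n + m - (degree q + degree r) = (n - degree q) + (m - degree r)"
    using assms by simp
  moreover have "degree (q * r) \<le> n + m" using assms deg by simp
  ultimately have "rv (n + m) (q * r) = fps_X ^ (n - degree q) * fps_X ^ (m - degree r) *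
      (fps_of_poly (reflect_poly q) * fps_of_poly (reflect_poly r))"
    by (simp only: rv_reflect deg power_add reflect_poly_mult fps_of_poly_mult)
  thus ?thesis
    using assms by (simp only: rv_reflect mult_ac)
qed

lemma fps_map_rv: "f 0 = 0 \<Longrightarrow> fps_map f (rv n q) = rv n (map_poly f q)"
  by (rule fps_ext) (simp add: rv_nth coeff_map_poly)

lemma fps_mult_nth_lowest:
  fixes f g :: "'a::comm_ring_1 fps"
  assumes "\<And>i. i < n \<Longrightarrow> g $ i = 0"
  shows "(f * g) $ n = f $ 0 * g $ n"
proof -
  have "(f * g) $ n = (\<Sum>i=0..n. f $ i * g $ (n - i))" by (rule fps_mult_nth)
  also have "\<dots> = f $ 0 * g $ n"
    by (subst sum.remove[of _ 0]) (auto intro!: sum.neutral simp: assms)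
  finally show ?thesis .
qed

locale riccati = derivation D for D :: "'a::{idom,ring_char_0} \<Rightarrow> 'a" +
  fixes U :: 'a
begin

abbreviation DF :: "'a fps \<Rightarrow> 'a fps" where "DF \<equiv> fps_map D"

sublocale df: derivation DF
  by (rule derivation_fps_map)

text \<open>Twice the defining quadratic expression, multiplied by \<open>\<mu>\<close>.\<close>

definition ric :: "'a fps \<Rightarrow> 'a fps" where
  "ric f = fps_X * (2 * f * DF (DF f) - (DF f)^2) - 4 * (1 + fps_const U * fps_X) * f^2"

text \<open>\<open>ric\<close> is a quadratic form, and a constant factor passes through both
  derivatives.\<close>

lemma ric_mult_const:
  assumes "DF q = 0"
  shows "ric (f * q) = q^2 * ric f"
  unfolding ric_def df.D_mult assms mult_zero_right add_0_right by algebra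

text \<open>In a = f - g and b = f + g the difference of the two equations is linear in a. All
  derivative terms carry a factor \<open>fps_X\<close>, so the coefficient at n reads 8 f_0 a_n = 0
  once the lower a_i vanish.\<close>

lemma ric_unique:
  assumes "ric f = ric g" "f $ 0 = g $ 0" "f $ 0 \<noteq> 0"
  shows "f = g"
proof -
  define a b where "a = f - g" and "b = f + g"
  have ab: "2 * f = a + b" "2 * g = b - a" by (simp_all add: a_def b_def)
  have D2: "DF (2 * x) = 2 * DF x" for x by (simp add: df.D_mult)
  have "ric (2 * f) = 4 * ric f" for f
    unfolding ric_def D2 by algebra
  hence "ric (a + b) - ric (b - a) = 0" using assms(1) by (simp flip: ab)
  moreover have "ric (a + b) - ric (b - a)
      = 4 * (fps_X * (b * DF (DF a) + DF (DF b) * a - DF b * DF a))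
        - 4 * ((4 * (1 + fps_const U * fps_X) * b) * a)"
    unfolding ric_def df.D_add df.D_diff by algebra
  ultimately have eq: "4 * ((4 * (1 + fps_const U * fps_X) * b) * a)
      = 4 * (fps_X * (b * DF (DF a) + DF (DF b) * a - DF b * DF a))"
    by (simp only: right_minus_eq)
  have "(4::'a fps) \<noteq> 0" by simp
  with eq have eq: "(4 * (1 + fps_const U * fps_X) * b) * a
      = fps_X * (b * DF (DF a) + DF (DF b) * a - DF b * DF a)"
    by (simp only: mult_cancel_left simp_thms)
  have "a $ n = 0" for n
  proof (induction n rule: less_induct)
    case (less n)
    have "((4 * (1 + fps_const U * fps_X) * b) * a) $ n = 8 * f $ 0 * a $ n"
      by (subst fps_mult_nth_lowest[OF less])
        (simp_all add: b_def assms(2) numeral_fps_const)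
    moreover have "(fps_X * (b * DF (DF a) + DF (DF b) * a - DF b * DF a)) $ n = 0"
      using less by (cases n) (simp_all add: fps_mult_nth_lowest)
    ultimately show ?case using eq assms(3) by simp
  qed
  hence "a = 0" by (simp add: fps_eq_iff)
  thus ?thesis by (simp add: a_def)
qed

text \<open>The quadratic equation is reversed at the common weight 2p + 1. Summands without the
  factor \<lambda> + U get a factor 1 of weight 1, which reverses to \<open>fps_X\<close>.
  \<open>rv\<close> with a fixed weight is used because derivatives of a may drop in degree.\<close>

lemma ric_reflect:
  fixes a S :: "'a poly"
  assumes a: "degree a = p" and S: "degree S = 2 * p + 1"
    and eq: "4 * S = 4 * [:U, 1:] * a^2 - 2 * a * map_poly D (map_poly D a) + (map_poly D a)^2"
  shows "ric (fps_of_poly (reflect_poly a)) = - 4 * fps_of_poly (reflect_poly S)"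
proof -
  let ?d = "map_poly D"
  have da: "degree (?d a) \<le> p" "degree (?d (?d a)) \<le> p"
    using a by (auto intro!: degree_le simp: coeff_map_poly coeff_eq_0)
  have X: "rv 1 [:U, 1:] = 1 + fps_const U * fps_X"
    by (rule fps_ext) (auto simp: rv_nth coeff_pCons split: nat.split)
  have 1: "rv 1 1 = (fps_X :: 'a fps)"
    by (rule fps_ext) (auto simp: rv_nth)
  have num: "rv n (numeral k * q) = numeral k * rv n q" for n k and q :: "'a poly"
    by (rule fps_ext) (simp add: rv_nth numeral_poly numeral_fps_const)
  have "rv (p + p) (x * y) * rv 1 z = rv p x * rv p y * rv 1 z"
    if "degree x \<le> p" "degree y \<le> p" for x y z :: "'a poly"
    using that by (simp add: rv_mult)
  hence m: "rv (p + p + 1) (x * y * z) = rv p x * rv p y * rv 1 z"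
    if "degree x \<le> p" "degree y \<le> p" "degree z \<le> 1" for x y z :: "'a poly"
    using that degree_mult_le[of x y] by (subst rv_mult) auto
  define Xp where "Xp = [:U, 1:]"
  have Xp: "degree Xp \<le> 1" by (simp add: Xp_def)
  have "4 * S + 2 * (a * ?d (?d a) * 1) = 4 * (a * a * Xp) + ?d a * ?d a * 1"
    unfolding eq Xp_def by algebra
  hence "rv (p + p + 1) (4 * S + 2 * (a * ?d (?d a) * 1))
      = rv (p + p + 1) (4 * (a * a * Xp) + ?d a * ?d a * 1)"
    by (simp only:)
  moreover have "rv (p + p + 1) (a * a * Xp) = rv p a * rv p a * (1 + fps_const U * fps_X)"
    unfolding m[OF eq_refl[OF a] eq_refl[OF a] Xp] using X by (simp only: Xp_def)
  moreover have "rv (p + p + 1) (a * ?d (?d a) * 1) = rv p a * rv p (?d (?d a)) * fps_X"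
      "rv (p + p + 1) (?d a * ?d a * 1) = rv p (?d a) * rv p (?d a) * fps_X"
    by (simp_all only: m a da order_refl degree_1 zero_le 1)
  ultimately have "4 * rv (p + p + 1) S + 2 * (rv p a * rv p (?d (?d a)) * fps_X)
     = 4 * (rv p a * rv p a * (1 + fps_const U * fps_X)) + rv p (?d a) * rv p (?d a) * fps_X"
    by (simp only: rv_add num)
  moreover have "rv p a = fps_of_poly (reflect_poly a)"
     "rv (p + p + 1) S = fps_of_poly (reflect_poly S)"
    using a S by (simp_all add: rv_reflect mult_2)
  moreover have "rv p (?d a) = DF (rv p a)" "rv p (?d (?d a)) = DF (DF (rv p a))"
    by (simp_all add: fps_map_rv)
  ultimately have "4 * fps_of_poly (reflect_poly S)
      + 2 * (fps_of_poly (reflect_poly a) * DF (DF (fps_of_poly (reflect_poly a))) * fps_X)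
     = 4 * (fps_of_poly (reflect_poly a) * fps_of_poly (reflect_poly a) * (1 + fps_const U * fps_X))
       + DF (fps_of_poly (reflect_poly a)) * DF (fps_of_poly (reflect_poly a)) * fps_X"
    by (simp only:)
  thus ?thesis
    unfolding ric_def by algebra
qed

end

subsection \<open>Square roots of formal series\<close>

lemma rhom_cV: "rhom cV"
  by standard (simp_all add: cV_def one_pCons)

text \<open>Existence: c times the binomial series \<open>(1 + z)^(1/2)\<close> at z = G/c^2 - 1,
  which has constant term 0. Uniqueness: in a domain the only other root is -s, whose constant term
  has negative real part.\<close>

lemma rsqrt_props:
  assumes "lead_coeff P = cV (c^2)" "Re c > 0"
  shows "rsqrt P * rsqrt P = fps_of_poly (reflect_poly P)" "rsqrt P $ 0 = cV c"
proof -
  interpret cV: rhom cV by (rule rhom_cV)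
  interpret cVf: rhom "fps_map cV" by (rule cV.rhom_fps_map)
  have cV_eq: "cV x = cV y \<longleftrightarrow> x = y" for x y by (simp add: cV_def)
  define G where "G = fps_of_poly (reflect_poly P)"
  have c0: "c \<noteq> 0" using assms(2) by auto
  define z where "z = fps_const (cV (1 / c^2)) * G - 1"
  have G0: "G $ 0 = cV (c^2)" using assms(1) by (simp add: G_def)
  have z0: "z $ 0 = 0"
    using c0 by (simp add: z_def G0 flip: cV.h_mult)
  define B where "B = fps_map cV (fps_binomial (1/2))"
  have "B * B = fps_map cV (fps_binomial (1/2) * fps_binomial (1/2))"
    by (simp add: B_def cVf.h_mult)
  also have "\<dots> = fps_map cV (1 + fps_X)"
    by (simp flip: fps_binomial_add_mult add: fps_binomial_1)
  also have "\<dots> = 1 + fps_X"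
    by (rule fps_ext) (simp add: cV.h_add fps_X_def)
  finally have BB: "B * B = 1 + fps_X" .
  define s where "s = fps_const (cV c) * (B oo z)"
  have "s * s = fps_const (cV (c^2)) * ((B * B) oo z)"
  proof -
    have "fps_const (cV (c^2)) = fps_const (cV c) * fps_const (cV c)"
      by (simp add: power2_eq_square cV.h_mult)
    thus ?thesis by (simp only: s_def fps_compose_mult_distrib[OF z0] mult_ac)
  qed
  also have "(B * B) oo z = fps_const (cV (1 / c^2)) * G"
    by (simp add: BB fps_compose_add_distrib z0) (simp add: z_def)
  also have "fps_const (cV (c^2)) * (fps_const (cV (1 / c^2)) * G) = G"
    using c0 by (simp add: mult.assoc[symmetric] flip: cV.h_mult)
  finally have ss: "s * s = G" .
  have s0: "s $ 0 = cV c"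
    by (simp add: s_def B_def)
  have "rsqrt P = s"
    unfolding rsqrt_def
  proof (rule the_equality)
    show "s * s = fps_of_poly (reflect_poly P) \<and> (\<exists>c. s $ 0 = cV c \<and> 0 < Re c)"
      using ss s0 assms(2) by (auto simp: G_def)
    show "t = s" if "t * t = fps_of_poly (reflect_poly P) \<and> (\<exists>c. t $ 0 = cV c \<and> 0 < Re c)" for t
    proof -
      from that obtain c' where t: "t * t = s * s" "t $ 0 = cV c'" "Re c' > 0"
        by (auto simp: ss G_def)
      have "t \<noteq> - s"
      proof
        assume "t = - s"
        hence "cV c' = cV (- c)" using t(2) s0 by (simp add: cV.h_minus)
        hence "c' = - c" by (simp only: cV_eq)
        thus False using t(3) assms(2) by simp
      qed
      thus ?thesis using t(1) by (simp add: square_eq_iff)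
    qed
  qed
  thus "rsqrt P * rsqrt P = fps_of_poly (reflect_poly P)" "rsqrt P $ 0 = cV c"
    using ss s0 by (simp_all add: G_def)
qed


subsection \<open>The differential ring of the curve\<close>

text \<open>\<open>curveQ\<close> is \<wp>'^2 = 4 \<wp>^3 - g2 \<wp> - g3 and \<open>curveH\<close>
  is \<wp>'' = 6 \<wp>^2 - g2/2, both as polynomials in \<wp> over C[g2, g3].\<close>

definition curveQ :: "complex poly poly poly" where
  "curveQ = [:- [:0, 1:], - [:[:0, 1:]:], 0, 4:]"

definition curveH :: "complex poly poly poly" where
  "curveH = [:- [:[:0, 1/2:]:], 0, 6:]"

lemma rel_eq: "rel = [:- curveQ, 0, 1:]"
  by (simp add: rel_def curveQ_def wp'_def wp_def g2_def g3_def power2_eq_square power3_eq_cube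
      numeral_poly one_pCons)

lemma pderiv_curveQ: "pderiv curveQ = 2 * curveH"
  by (simp add: curveQ_def curveH_def pderiv_pCons numeral_poly one_pCons)

lemma Dx_eq: "Dx f = wp' * map_poly pderiv f + [:curveH:] * pderiv f"
  by (simp add: Dx_def curveH_def wp_def g2_def cV_def power2_eq_square numeral_poly one_pCons)

lemma derivation_pderiv:
  "derivation (pderiv :: 'a poly \<Rightarrow> 'a::{comm_ring_1,semiring_no_zero_divisors} poly)"
  by standard (simp_all add: pderiv_add pderiv_mult algebra_simps)

interpretation Dx: derivation Dx
proof -
  interpret p: derivation "pderiv :: complex poly poly poly \<Rightarrow> _" by (rule derivation_pderiv)
  interpret q: derivation "map_poly pderiv :: R \<Rightarrow> R" by (rule p.derivation_map_poly)
  show "derivation Dx"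
    by standard (simp_all add: Dx_eq q.D_add q.D_mult pderiv_add pderiv_mult algebra_simps)
qed

text \<open>Differentiating gives \<wp>' (2 \<wp>'' - Q'(\<wp>)), which is 0. Hence the ideal of
  \<open>rel\<close> is stable and the derivation descends to the quotient.\<close>

lemma Dx_rel: "Dx rel = 0"
proof -
  have "pderiv (- curveQ) = - (2 * curveH)"
    by (simp add: pderiv_minus pderiv_curveQ)
  thus ?thesis
    by (simp add: Dx_eq rel_eq wp'_def map_poly_pCons pderiv_pCons numeral_poly one_pCons)
qed

section \<open>The quotient ring V and its derivation\<close>

lemma veq_refl [simp]: "veq x x"
  by (simp add: veq_def)

lemma equivp_veq: "equivp veq"
proof (rule equivpI)
  show "reflp veq" by (simp add: reflp_def)
  show "symp veq"
  proof (rule sympI)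
    show "veq y x" if "veq x y" for x y
      using that dvd_minus_iff[of rel "x - y"] by (simp add: veq_def)
  qed
  show "transp veq"
  proof (rule transpI)
    show "veq x z" if "veq x y" "veq y z" for x y z
      using dvd_add[OF that[unfolded veq_def]] by (simp add: veq_def)
  qed
qed

quotient_type V = R / veq
  by (rule equivp_veq)

instantiation V :: comm_ring_1
begin

lift_definition zero_V :: V is 0 .
lift_definition one_V :: V is 1 .
lift_definition plus_V :: "V \<Rightarrow> V \<Rightarrow> V" is "(+)"
proof -
  fix a b c d assume "veq a b" "veq c d"
  thus "veq (a + c) (b + d)"
    using dvd_add[of rel "a - b" "c - d"] by (simp add: veq_def algebra_simps)
qed
lift_definition uminus_V :: "V \<Rightarrow> V" is uminus
proof -
  fix a b assume "veq a b"
  thus "veq (- a) (- b)"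
    using dvd_minus_iff[of rel "a - b"] by (simp add: veq_def)
qed
lift_definition minus_V :: "V \<Rightarrow> V \<Rightarrow> V" is "(-)"
proof -
  fix a b c d assume "veq a b" "veq c d"
  thus "veq (a - c) (b - d)"
    using dvd_diff[of rel "a - b" "c - d"] by (simp add: veq_def algebra_simps)
qed
lift_definition times_V :: "V \<Rightarrow> V \<Rightarrow> V" is "(*)"
proof -
  fix a b c d assume "veq a b" "veq c d"
  moreover have "a * c - b * d = (a - b) * c + b * (c - d)" by (simp add: algebra_simps)
  ultimately show "veq (a * c) (b * d)" by (simp add: veq_def dvd_add)
qed

instance
proof
  have "\<not> rel dvd (-1)"
  proof
    assume "rel dvd (-1)"
    hence "degree rel \<le> degree (-1 :: R)" by (rule dvd_imp_degree_le) simp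
    thus False by (simp add: rel_eq)
  qed
  thus "(0::V) \<noteq> 1" by transfer (simp add: veq_def)
qed (transfer; simp add: algebra_simps)+

end

interpretation abs_V: rhom abs_V
  by standard (simp_all add: plus_V.abs_eq times_V.abs_eq one_V.abs_eq)

lemma veq_iff: "veq x y \<longleftrightarrow> abs_V x = abs_V y"
  by (simp add: V.abs_eq_iff)

lift_definition DV :: "V \<Rightarrow> V" is Dx
proof -
  fix x y assume "veq x y"
  then obtain z where "x - y = rel * z" by (auto simp: veq_def)
  hence "Dx x - Dx y = rel * Dx z" by (simp add: Dx.D_mult Dx_rel flip: Dx.D_diff)
  thus "veq (Dx x) (Dx y)" by (simp add: veq_def)
qed

interpretation DV: derivation DV
proof
  show "DV (x + y) = DV x + DV y" for x y
    by transfer (simp add: Dx.D_add)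
  show "DV (x * y) = DV x * y + x * DV y" for x y
    by transfer (simp add: Dx.D_mult)
qed

section \<open>V as a quadratic extension of C[g2, g3][\<wp>]\<close>

definition iota :: "complex poly poly poly \<Rightarrow> V" where
  "iota f = abs_V [:f:]"

definition yV :: V where
  "yV = abs_V wp'"

interpretation iota: rhom iota
proof
  show "iota (f + g) = iota f + iota g" for f g
    by (simp add: iota_def flip: abs_V.h_add)
  show "iota (f * g) = iota f * iota g" for f g
    by (simp add: iota_def mult.commute flip: abs_V.h_mult)
  show "iota 1 = 1"
    by (simp add: iota_def flip: one_pCons)
qed

lemma yV_square: "yV * yV = iota curveQ"
proof -
  have "wp' * wp' - [:curveQ:] = rel" by (simp add: rel_eq wp'_def)
  hence "veq (wp' * wp') [:curveQ:]" by (simp add: veq_def)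
  thus ?thesis by (simp add: yV_def iota_def veq_iff flip: abs_V.h_mult)
qed

lemma DV_iota: "DV (iota f) = yV * iota (pderiv f)"
  by (simp add: iota_def yV_def DV.abs_eq Dx_eq map_poly_pCons flip: abs_V.h_mult)

lemma DV_yV: "DV yV = iota curveH"
  by (simp add: iota_def yV_def DV.abs_eq Dx_eq wp'_def map_poly_pCons pderiv_pCons)

text \<open>Reduction by \<open>rel\<close>, which is monic and quadratic in \<wp>'. Together with
  \<open>V_eq_0_iff\<close>, V is free over C[g2, g3][\<wp>] with basis 1, \<wp>'.\<close>

lemma V_cases:
  obtains f g where "v = iota f + yV * iota g"
proof -
  obtain x where v: "v = abs_V x" by (metis Quotient3_abs_rep[OF Quotient3_V])
  have "\<exists>f g. abs_V x = iota f + yV * iota g"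
  proof (induction x)
    case 0
    show ?case by (intro exI[of _ 0]) simp
  next
    case (pCons c x)
    then obtain f g where "abs_V x = iota f + yV * iota g" by blast
    moreover have "abs_V (pCons c x) = iota c + yV * abs_V x"
      by (simp add: iota_def yV_def wp'_def flip: abs_V.h_mult abs_V.h_add)
    ultimately have "abs_V (pCons c x) = iota (c + curveQ * g) + yV * iota f"
      by (simp add: iota.h_add iota.h_mult algebra_simps flip: yV_square)
    thus ?case by blast
  qed
  thus ?thesis using that v by blast
qed

lemma V_eq_0_iff: "iota f + yV * iota g = 0 \<longleftrightarrow> f = 0 \<and> g = 0"
proof
  assume "iota f + yV * iota g = 0"
  moreover have "iota f + yV * iota g = abs_V [:f, g:]"
    by (simp add: iota_def yV_def wp'_def flip: abs_V.h_mult abs_V.h_add)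
  ultimately have "veq [:f, g:] 0" by (simp add: veq_iff)
  hence "rel dvd [:f, g:]" by (simp add: veq_def)
  moreover have "degree [:f, g:] < degree rel" by (simp add: rel_eq)
  ultimately have "[:f, g:] = 0" using dvd_imp_degree_le by fastforce
  thus "f = 0 \<and> g = 0" by simp
qed simp

lemma iota_eq_iff: "iota f = iota g \<longleftrightarrow> f = g"
  using V_eq_0_iff[of "f - g" 0] by (simp add: iota.h_diff)

text \<open>Multiplying v by its conjugate gives the norm N = f^2 - Q g^2, which is nonzero because
  Q has odd degree in \<wp>. So v w = 0 gives N w = 0, and N cancels componentwise.\<close>

instance V :: idom
proof
  fix v w :: V
  assume "v \<noteq> 0" "w \<noteq> 0"
  obtain f g where v: "v = iota f + yV * iota g" by (rule V_cases)
  obtain f' g' where w: "w = iota f' + yV * iota g'" by (rule V_cases)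
  define N where "N = f * f - g * g * curveQ"
  have "N \<noteq> 0"
  proof
    assume "N = 0"
    hence eq: "f * f = g * g * curveQ" by (simp add: N_def)
    have q: "curveQ \<noteq> 0" "degree curveQ = 3" by (simp_all add: curveQ_def)
    have "f \<noteq> 0 \<or> g \<noteq> 0" using \<open>v \<noteq> 0\<close> v by auto
    hence nz: "f \<noteq> 0" "g \<noteq> 0" using eq q by auto
    hence "2 * degree f = 2 * degree g + 3"
      using arg_cong[OF eq, of degree] q by (simp add: degree_mult_eq)
    thus False by presburger
  qed
  show "v * w \<noteq> 0"
  proof
    assume "v * w = 0"
    have "(iota f - yV * iota g) * v = iota (f * f) - yV * yV * iota (g * g)"
      by (simp add: v iota.h_mult algebra_simps)
    also have "\<dots> = iota N"
      by (simp add: yV_square N_def iota.h_mult iota.h_diff)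
    finally have "iota N * w = (iota f - yV * iota g) * (v * w)"
      by (simp flip: mult.assoc)
    hence "iota N * w = 0" by (simp add: \<open>v * w = 0\<close>)
    hence "iota (N * f') + yV * iota (N * g') = 0"
      by (simp add: w iota.h_mult algebra_simps)
    hence "N * f' = 0" "N * g' = 0" by (simp_all only: V_eq_0_iff)
    thus False using \<open>N \<noteq> 0\<close> \<open>w \<noteq> 0\<close> w by simp
  qed
qed

instance V :: ring_char_0
proof
  show "inj (of_nat :: nat \<Rightarrow> V)"
  proof (rule injI)
    fix m n assume "(of_nat m :: V) = of_nat n"
    hence "iota (of_nat m) = iota (of_nat n)" by simp
    thus "m = n" by (simp only: iota_eq_iff of_nat_eq_iff)
  qed
qed

text \<open>A primitive of \<open>\<wp>' q\<close> has no odd part, because \<open>2Q g' + Q' g\<close> has leading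
  coefficient \<open>(8 deg g + 12) lc g\<close>.\<close>

lemma DV_eq_iota:
  assumes "numeral k * DV v = yV * iota q"
  obtains f where "v = iota f" "numeral k * pderiv f = q"
proof -
  obtain f g where v: "v = iota f + yV * iota g" by (rule V_cases)
  have "DV v = iota (curveH * g + curveQ * pderiv g) + yV * iota (pderiv f)"
    by (simp add: v DV.D_add DV.D_mult DV_iota DV_yV iota.h_add iota.h_mult algebra_simps
        flip: yV_square)
  hence "iota (numeral k * (curveH * g + curveQ * pderiv g))
       + yV * iota (numeral k * pderiv f - q) = 0"
    using assms by (simp add: iota.h_mult iota.h_add iota.h_diff algebra_simps)
  hence "numeral k * (curveH * g + curveQ * pderiv g) = 0" and f: "numeral k * pderiv f = q"
    unfolding V_eq_0_iff by simp_all
  hence g0: "curveH * g + curveQ * pderiv g = 0" by (simp only: mult_eq_0_iff) simp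
  have "g = 0"
  proof (rule ccontr)
    assume "g \<noteq> 0"
    \<comment> \<open>Half of the combination named above, since H = Q'/2.\<close>
    have "coeff (curveH * g + curveQ * pderiv g) (degree g + 2)
        = of_nat (6 + 4 * degree g) * lead_coeff g"
      by (cases "degree g")
        (simp_all add: curveH_def curveQ_def coeff_pderiv coeff_pCons coeff_eq_0 numeral_2_eq_2
          algebra_simps split: nat.split)
    thus False using g0 \<open>g \<noteq> 0\<close> by (simp del: of_nat_add of_nat_mult)
  qed
  thus ?thesis using that v f by simp
qed

subsection \<open>The Lame equation\<close>

abbreviation k2 :: "complex poly poly" where "k2 \<equiv> [:[:0, 1:]:]"
abbreviation k3 :: "complex poly poly" where "k3 \<equiv> [:0, 1:]"

definition UP :: "nat \<Rightarrow> complex poly poly poly" where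
  "UP p = [:0, of_nat (p * (p + 1)):]"

definition UV :: "nat \<Rightarrow> V" where
  "UV p = iota (UP p)"

text \<open>\<open>2 f\<^sub>x\<^sub>x\<^sub>x - 8 U f\<^sub>x - 4 U\<^sub>x f\<close> for \<open>f\<close> a polynomial in \<open>\<wp>\<close>, divided by \<open>\<wp>'\<close>.\<close>

definition lame :: "nat \<Rightarrow> complex poly poly poly \<Rightarrow> complex poly poly poly" where
  "lame p f = pderiv (2 * curveQ * pderiv (pderiv f) + pderiv curveQ * pderiv f)
     - 8 * UP p * pderiv f - 4 * pderiv (UP p) * f"

lemma coeff_numeral_mult: "coeff (numeral m * q) k = numeral m * coeff q k"
  and coeff_of_nat_mult: "coeff (of_nat i * q) k = of_nat i * coeff q k"
  by (simp_all add: numeral_poly of_nat_poly)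

text \<open>The operator sends \<open>\<wp>^m\<close> to a combination of \<open>\<wp>^m\<close>,
  \<open>\<wp>^(m-2)\<close> and \<open>\<wp>^(m-3)\<close>. The diagonal factor vanishes only at n
  = p.\<close>

lemma coeff_lame:
  "coeff (lame p f) n =
     4 * of_nat (2 * n + 1) * (of_nat (n * (n + 1)) - of_nat (p * (p + 1))) * coeff f n
     - of_nat ((n + 1) * (n + 2) * (2 * n + 3)) * k2 * coeff f (n + 2)
     - 2 * of_nat ((n + 1) * (n + 2) * (n + 3)) * k3 * coeff f (n + 3)"
proof -
  define a b where "a = k2" and "b = k3"
  define u :: "complex poly poly" where "u = of_nat (p * (p + 1))"
  have Q: "curveQ = [:- b, - a, 0, 4:]" by (simp add: curveQ_def a_def b_def)
  have U: "UP p = [:0, u:]" by (simp add: UP_def u_def)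
  have c1: "coeff (curveQ * pderiv (pderiv f)) (Suc n)
      = 4 * of_nat n * (of_nat n - 1) * coeff f n - of_nat (n + 2) * of_nat (n + 1) * a * coeff f (n + 2)
        - of_nat (n + 3) * of_nat (n + 2) * b * coeff f (n + 3)"
  proof -
    consider "n = 0" | "n = 1" | m where "n = Suc (Suc m)"
      by (metis One_nat_def not0_implies_Suc)
    thus ?thesis
      by cases (simp_all add: Q coeff_pderiv algebra_simps numeral_2_eq_2 numeral_3_eq_3)
  qed
  have c2: "coeff (pderiv curveQ * pderiv f) (Suc n)
      = 12 * of_nat n * coeff f n - a * of_nat (n + 2) * coeff f (n + 2)"
    by (cases n) (simp_all add: Q pderiv_pCons coeff_pderiv algebra_simps numeral_2_eq_2)
  have c3: "coeff (UP p * pderiv f) n = u * of_nat n * coeff f n"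
    by (cases n) (simp_all add: U coeff_pderiv algebra_simps)
  have c4: "coeff (pderiv (UP p) * f) n = u * coeff f n"
    by (simp add: U pderiv_pCons)
  have "coeff (lame p f) n
     = of_nat (Suc n) * (2 * coeff (curveQ * pderiv (pderiv f)) (Suc n)
         + coeff (pderiv curveQ * pderiv f) (Suc n))
       - 8 * coeff (UP p * pderiv f) n - 4 * coeff (pderiv (UP p) * f) n"
    by (simp only: lame_def mult.assoc coeff_diff coeff_add coeff_pderiv coeff_numeral_mult)
  also have "\<dots> = 4 * of_nat (2 * n + 1) * (of_nat (n * (n + 1)) - u) * coeff f n
     - of_nat ((n + 1) * (n + 2) * (2 * n + 3)) * a * coeff f (n + 2)
     - 2 * of_nat ((n + 1) * (n + 2) * (n + 3)) * b * coeff f (n + 3)"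
    unfolding c1 c2 c3 c4 by (simp add: algebra_simps)
  finally show ?thesis by (simp only: a_def b_def u_def)
qed

lemma DV_DV_iota: "2 * DV (DV (iota f)) = iota (2 * curveQ * pderiv (pderiv f) + pderiv curveQ * pderiv f)"
  by (simp add: DV_iota DV.D_mult DV_yV pderiv_curveQ iota.h_add iota.h_mult algebra_simps
      flip: yV_square)

lemma lame_iota:
  "yV * iota (lame p f)
     = 2 * DV (DV (DV (iota f))) - 8 * UV p * DV (iota f) - 4 * DV (UV p) * iota f"
proof -
  have "2 * DV (DV (DV (iota f))) = DV (2 * DV (DV (iota f)))"
    by (simp add: DV.D_mult)
  also have "\<dots> = yV * iota (pderiv (2 * curveQ * pderiv (pderiv f) + pderiv curveQ * pderiv f))"
    by (subst DV_DV_iota) (rule DV_iota)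
  finally show ?thesis
    by (simp add: lame_def UV_def DV_iota iota.h_add iota.h_diff iota.h_mult algebra_simps)
qed

lemma oblong_diff_nonzero:
  assumes "n < p"
  shows "(of_nat (n * (n + 1)) :: 'a::ring_char_0) - of_nat (p * (p + 1)) \<noteq> 0"
proof -
  have "n * (n + 1) < p * (p + 1)" using assms by (intro mult_strict_mono) simp_all
  thus ?thesis by (simp only: right_minus_eq of_nat_eq_iff)
qed

section \<open>The linear third-order equation over V[\<lambda>]\<close>

definition lame_eq :: "nat \<Rightarrow> V poly \<Rightarrow> bool" where
  "lame_eq p a \<longleftrightarrow> map_poly DV (map_poly DV (map_poly DV a))
     = 4 * [:UV p, 1:] * map_poly DV a + 2 * [:DV (UV p):] * a"

text \<open>Comparison of the coefficients of \<open>\<lambda>^k\<close>, doubled so that the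
  left-hand side is that of \<open>lame_iota\<close>.\<close>

lemma lame_eq_iff:
  "lame_eq p a \<longleftrightarrow>
     (\<forall>k. 2 * DV (DV (DV (coeff a k))) - 8 * UV p * DV (coeff a k) - 4 * DV (UV p) * coeff a k
        = 8 * (case k of 0 \<Rightarrow> 0 | Suc j \<Rightarrow> DV (coeff a j)))"
proof -
  have "lame_eq p a \<longleftrightarrow> (\<forall>k. DV (DV (DV (coeff a k)))
     = 4 * (UV p * DV (coeff a k) + (case k of 0 \<Rightarrow> 0 | Suc j \<Rightarrow> DV (coeff a j)))
       + 2 * (DV (UV p) * coeff a k))"
    unfolding lame_eq_def poly_eq_iff mult.assoc coeff_add coeff_numeral_mult
    by (simp add: coeff_map_poly coeff_pCons split: nat.split)
  also have "\<dots> \<longleftrightarrow> (\<forall>k. 2 * DV (DV (DV (coeff a k)))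
     = 2 * (4 * (UV p * DV (coeff a k) + (case k of 0 \<Rightarrow> 0 | Suc j \<Rightarrow> DV (coeff a j)))
       + 2 * (DV (UV p) * coeff a k)))"
    by (simp only: mult_cancel_left) simp
  also have "\<dots> \<longleftrightarrow>
     (\<forall>k. 2 * DV (DV (DV (coeff a k))) - 8 * UV p * DV (coeff a k) - 4 * DV (UV p) * coeff a k
        = 8 * (case k of 0 \<Rightarrow> 0 | Suc j \<Rightarrow> DV (coeff a j)))"
    by (intro all_cong1) (simp add: algebra_simps)
  finally show ?thesis .
qed

lemma lame_eq_diff:
  assumes "lame_eq p a" "lame_eq p b"
  shows "lame_eq p (a - b)"
proof -
  interpret d: derivation "map_poly DV" by (rule DV.derivation_map_poly)
  show ?thesis using assms unfolding lame_eq_def d.D_diff by algebra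
qed

text \<open>Descending in powers of \<open>\<lambda>\<close>, the coefficient of \<open>\<lambda>\<^bsup>m-j\<^esup>\<close> has exact degree \<open>j\<close> in \<open>\<wp>\<close>;
  the equation at \<open>\<lambda>\<^sup>0\<close> then fails in degree \<open>m < p\<close>.\<close>

lemma lame_eq_low_degree:
  assumes "lame_eq p a" and low: "\<And>k. k \<ge> p \<Longrightarrow> coeff a k = 0"
  shows "a = 0"
proof (rule ccontr)
  assume "a \<noteq> 0"
  define m where "m = degree a"
  have am: "coeff a m \<noteq> 0" using \<open>a \<noteq> 0\<close> by (simp add: m_def)
  hence "m < p" using low not_le by blast
  have lead: "coeff (lame p f) j \<noteq> 0" "\<And>n. n > j \<Longrightarrow> coeff (lame p f) n = 0"
    if "degree f \<le> j" "coeff f j \<noteq> 0" "j < p" for f j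
  proof -
    have z: "coeff f n = 0" if "n > j" for n
      using \<open>degree f \<le> j\<close> that by (simp add: coeff_eq_0)
    have "coeff f (j + 2) = 0" "coeff f (j + 3) = 0" by (simp_all only: z)
    hence "coeff (lame p f) j
        = 4 * of_nat (2 * j + 1) * (of_nat (j * (j + 1)) - of_nat (p * (p + 1))) * coeff f j"
      by (simp only: coeff_lame mult_zero_right diff_zero)
    moreover have "(of_nat (2 * j + 1) :: complex poly poly) \<noteq> 0"
      by (simp only: of_nat_eq_0_iff)
    ultimately show "coeff (lame p f) j \<noteq> 0"
      using that(2) oblong_diff_nonzero[OF \<open>j < p\<close>] by (simp only: mult_eq_0_iff) simp
    show "coeff (lame p f) n = 0" if "n > j" for n
    proof -
      have "coeff f n = 0" "coeff f (n + 2) = 0" "coeff f (n + 3) = 0"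
        using that by (simp_all add: z)
      thus ?thesis by (simp only: coeff_lame mult_zero_right diff_zero)
    qed
  qed
  have eq: "yV * iota (lame p f) = 8 * (case k of 0 \<Rightarrow> 0 | Suc j \<Rightarrow> DV (coeff a j))"
    if "coeff a k = iota f" for k f
    using assms(1) by (simp add: lame_eq_iff lame_iota flip: that)
  have "\<exists>f. coeff a (m - j) = iota f \<and> degree f \<le> j \<and> coeff f j \<noteq> 0" if "j \<le> m" for j
    using that
  proof (induction j)
    case 0
    \<comment> \<open>The equation at \<open>\<lambda>^(m+1)\<close>, where a itself has coefficient
      0, makes the leading coefficient of a constant.\<close>
    have "coeff a (Suc m) = iota 0" by (simp add: m_def coeff_eq_0)
    from eq[OF this] have "8 * DV (coeff a m) = yV * iota (lame p 0)" by simp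
    also have "lame p 0 = 0" by (simp add: lame_def)
    finally obtain f where f: "coeff a m = iota f" "8 * pderiv f = 0"
      by (rule DV_eq_iota)
    hence "degree f = 0" by (simp add: pderiv_eq_0_iff)
    moreover have "f \<noteq> 0" using am f by auto
    ultimately show ?case using f(1) by (metis diff_zero le_refl leading_coeff_0_iff)
  next
    case (Suc j)
    then obtain f where f: "coeff a (m - j) = iota f" "degree f \<le> j" "coeff f j \<noteq> 0"
      by auto
    have "j < p" using Suc.prems \<open>m < p\<close> by simp
    \<comment> \<open>The next lower coefficient g is a primitive of \<open>lame p f\<close>, which
      has exact degree j as j < p. Integration raises this to j + 1.\<close>
    have "m - j = Suc (m - Suc j)" using Suc.prems by simp
    with eq[OF f(1)] have "8 * DV (coeff a (m - Suc j)) = yV * iota (lame p f)" by simp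
    then obtain g where g: "coeff a (m - Suc j) = iota g" "8 * pderiv g = lame p f"
      by (rule DV_eq_iota)
    have cg: "8 * (of_nat (Suc n) * coeff g (Suc n)) = coeff (lame p f) n" for n
      unfolding g(2)[symmetric] by (simp add: coeff_pderiv numeral_poly)
    have "coeff g (Suc j) \<noteq> 0" using cg[of j] lead(1)[OF f(2,3) \<open>j < p\<close>] by auto
    moreover have "coeff g n = 0" if n: "n > Suc j" for n
    proof -
      obtain i where i: "n = Suc i" "i > j" using n by (cases n) auto
      have "8 * (of_nat (Suc i) * coeff g (Suc i)) = 0"
        using cg[of i] lead(2)[OF f(2,3) \<open>j < p\<close> i(2)] by simp
      thus ?thesis using i by (simp del: of_nat_Suc)
    qed
    hence "degree g \<le> Suc j" by (simp add: degree_le)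
    ultimately show ?case using g(1) by blast
  qed
  from this[of m] obtain f where f: "coeff a 0 = iota f" "degree f \<le> m" "coeff f m \<noteq> 0" by auto
  from eq[OF f(1)] have "iota 0 + yV * iota (lame p f) = 0" by simp
  hence "lame p f = 0" by (simp only: V_eq_0_iff)
  thus False using lead(1)[OF f(2,3) \<open>m < p\<close>] by simp
qed

text \<open>The coefficient of \<open>\<wp>\<^sup>n\<close> in the polynomial solution, up to normalisation, as a polynomial
  in \<open>\<lambda>\<close>; the recursion solves \<open>lame p f = 8 \<lambda> \<partial>f/\<partial>\<wp>\<close> for the coefficient of \<open>\<wp>\<^sup>n\<close>.\<close>

function alpha :: "nat \<Rightarrow> nat \<Rightarrow> complex poly poly poly" where
  "alpha p n = (if n > p then 0 else if n = p then 1 else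
     smult [:[:1 / (4 * of_nat (2 * n + 1) * (of_nat (n * (n + 1)) - of_nat (p * (p + 1)))):]:]
      (8 * of_nat (n + 1) * pCons 0 (alpha p (n + 1))
       + of_nat ((n + 1) * (n + 2) * (2 * n + 3)) * [:k2:] * alpha p (n + 2)
       + 2 * of_nat ((n + 1) * (n + 2) * (n + 3)) * [:k3:] * alpha p (n + 3)))"
  by auto
termination
  by (relation "measure (\<lambda>(p, n). p - n)") auto

declare alpha.simps [simp del]

text \<open>For n < p this is the definition with its denominator cleared. At n = p the factor on
  the left vanishes, and beyond p every term does, so stopping at \<open>\<wp>^p\<close> leaves no
  error term.\<close>

lemma alpha_rec:
  "4 * of_nat (2 * n + 1) * (of_nat (n * (n + 1)) - of_nat (p * (p + 1))) * alpha p n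
    = 8 * of_nat (n + 1) * pCons 0 (alpha p (n + 1))
       + of_nat ((n + 1) * (n + 2) * (2 * n + 3)) * [:k2:] * alpha p (n + 2)
       + 2 * of_nat ((n + 1) * (n + 2) * (n + 3)) * [:k3:] * alpha p (n + 3)" (is "_ = ?r")
proof (cases "n < p")
  case True
  define c :: complex where
    "c = 4 * of_nat (2 * n + 1) * (of_nat (n * (n + 1)) - of_nat (p * (p + 1)))"
  have "(of_nat (2 * n + 1) :: complex) \<noteq> 0" by (simp only: of_nat_eq_0_iff)
  hence "c \<noteq> 0"
    unfolding c_def using oblong_diff_nonzero[OF True] by (simp only: mult_eq_0_iff) simp
  hence inv: "[:[:[:c:]:]:] * smult [:[:1 / c:]:] q = q" for q :: "complex poly poly poly"
    by (simp flip: one_pCons)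
  have "alpha p n = smult [:[:1 / c:]:] ?r"
    using True by (subst alpha.simps) (simp only: c_def if_False less_not_sym less_imp_neq)
  moreover have "4 * of_nat (2 * n + 1) * (of_nat (n * (n + 1)) - of_nat (p * (p + 1)))
     = [:[:[:c:]:]:]"
    by (simp only: c_def of_nat_poly numeral_poly) simp
  ultimately show ?thesis by (simp only: inv)
next
  case False
  hence "alpha p (n + k) = 0" if "k > 0" for k using that by (simp add: alpha.simps)
  thus ?thesis using False by (cases "n = p") (simp_all add: alpha.simps)
qed

lemma coeff_alpha_rec:
  "4 * (of_nat (2 * n + 1) * ((of_nat (n * (n + 1)) - of_nat (p * (p + 1))) * coeff (alpha p n) k))
    = 8 * (of_nat (n + 1) * coeff (pCons 0 (alpha p (n + 1))) k)
      + of_nat ((n + 1) * (n + 2) * (2 * n + 3)) * (k2 * coeff (alpha p (n + 2)) k)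
      + 2 * (of_nat ((n + 1) * (n + 2) * (n + 3)) * (k3 * coeff (alpha p (n + 3)) k))"
proof -
  have const: "coeff ([:b:] * q) k = b * coeff q k" for b and q :: "complex poly poly poly"
    by simp
  show ?thesis
    using arg_cong[OF alpha_rec[of n p], of "\<lambda>q. coeff q k"]
    by (simp only: mult.assoc left_diff_distrib coeff_add coeff_diff coeff_numeral_mult
        coeff_of_nat_mult const)
qed

text \<open>The joint degree in \<lambda> and \<wp> is at most p, because each step down in n brings
  at most one factor \<lambda>.\<close>

lemma coeff_alpha_eq_0: "n + k > p \<Longrightarrow> coeff (alpha p n) k = 0"
proof (induction "p - n" arbitrary: n k rule: less_induct)
  case less
  show ?case
  proof (cases "n < p")
    case True
    have *: "coeff (alpha p (n + i)) j = 0" if "i > 0" "n + i + j > p" for i j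
      using less.hyps[of "n + i" j] True that by (cases "n + i \<le> p") (auto simp: alpha.simps)
    have "coeff (pCons 0 (alpha p (n + 1))) k = 0"
      using less.prems True *[of 1] by (cases k) auto
    moreover have "coeff (alpha p (n + 2)) k = 0" "coeff (alpha p (n + 3)) k = 0"
      using less.prems by (simp_all only: *)
    moreover have "(of_nat (2 * n + 1) :: complex poly poly) \<noteq> 0"
      by (simp only: of_nat_eq_0_iff)
    ultimately show ?thesis
      using coeff_alpha_rec[of n p k] oblong_diff_nonzero[where 'a = "complex poly poly", OF True]
      by (simp only: mult_zero_right add_0_right mult_eq_0_iff) simp
  qed (use less.prems in \<open>auto simp: alpha.simps\<close>)
qed

text \<open>In joint degree exactly p only the term with \<open>alpha p (n + 1)\<close> contributes,
  with a nonzero complex factor. The case n = 0 is what allows the solution to be made monic in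
  \<lambda>.\<close>

lemma coeff_alpha_top:
  assumes "n \<le> p"
  shows "\<exists>c. c \<noteq> 0 \<and> coeff (alpha p n) (p - n) = [:[:c:]:]"
  using assms
proof (induction n rule: inc_induct)
  case base
  show ?case by (rule exI[of _ 1]) (simp add: alpha.simps one_pCons)
next
  case (step n)
  then obtain c where c: "c \<noteq> 0" "coeff (alpha p (Suc n)) (p - Suc n) = [:[:c:]:]" by blast
  define s :: complex where
    "s = 4 * (of_nat (2 * n + 1) * (of_nat (n * (n + 1)) - of_nat (p * (p + 1))))"
  have "(of_nat (2 * n + 1) :: complex) \<noteq> 0" by (simp only: of_nat_eq_0_iff)
  hence "s \<noteq> 0"
    unfolding s_def using oblong_diff_nonzero[OF \<open>n < p\<close>] by (simp only: mult_eq_0_iff) simp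
  have s: "4 * (of_nat (2 * n + 1) * ((of_nat (n * (n + 1)) - of_nat (p * (p + 1))) * x))
     = [:[:s:]:] * x" for x :: "complex poly poly"
  proof -
    have "4 * (of_nat (2 * n + 1) * (of_nat (n * (n + 1)) - of_nat (p * (p + 1)))) = [:[:s:]:]"
      by (simp only: s_def of_nat_poly numeral_poly) simp
    thus ?thesis by (simp only: mult.assoc[symmetric])
  qed
  have "coeff (alpha p (n + 2)) (p - n) = 0" "coeff (alpha p (n + 3)) (p - n) = 0"
    by (rule coeff_alpha_eq_0, simp)+
  moreover have "coeff (pCons 0 (alpha p (n + 1))) (p - n) = [:[:c:]:]"
    using c(2) step by (cases "p - n") (simp_all, metis diff_Suc_Suc Suc_diff_Suc diff_Suc_1)
  ultimately have "[:[:s:]:] * coeff (alpha p n) (p - n) = 8 * (of_nat (n + 1) * [:[:c:]:])"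
    using coeff_alpha_rec[of n p "p - n"] by (simp only: s mult_zero_right add_0_right)
  also have "\<dots> = [:[:s:]:] * [:[:8 * of_nat (n + 1) * c / s:]:]"
    using \<open>s \<noteq> 0\<close> by (simp only: of_nat_poly numeral_poly) simp
  finally have "coeff (alpha p n) (p - n) = [:[:8 * of_nat (n + 1) * c / s:]:]"
    using \<open>s \<noteq> 0\<close> by (simp only: mult_cancel_left) simp
  moreover have "(of_nat (n + 1) :: complex) \<noteq> 0" by (simp only: of_nat_eq_0_iff)
  hence "8 * of_nat (n + 1) * c / s \<noteq> 0"
    using c(1) \<open>s \<noteq> 0\<close> by (simp only: divide_eq_0_iff mult_eq_0_iff) simp
  ultimately show ?case by blast
qed

lemma lame_eq_exists:
  obtains f where "f p = 1" "\<forall>k n. n + k > p \<longrightarrow> coeff (f k) n = 0" "coeff (f 0) p \<noteq> 0"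
    "lame p (f 0) = 0" "\<forall>k. lame p (f (Suc k)) = 8 * pderiv (f k)"
proof -
  obtain c where c: "c \<noteq> 0" "coeff (alpha p 0) p = [:[:c:]:]"
    using coeff_alpha_top[of 0 p] by auto
  \<comment> \<open>A transposition: \<open>alpha p n\<close> is the coefficient of
    \<open>\<wp>^n\<close> as a polynomial in \<lambda>, while \<open>f k\<close> is that of
    \<open>\<lambda>^k\<close> as a polynomial in \<wp>. Division by c makes the solution monic in
    \<lambda>.\<close>
  define f where "f k = (\<Sum>n\<le>p. monom ([:[:1 / c:]:] * coeff (alpha p n) k) n)" for k
  have cf: "coeff (f k) n = [:[:1 / c:]:] * coeff (alpha p n) k" for k n
  proof (cases "n \<le> p")
    case False
    thus ?thesis by (simp add: f_def coeff_sum coeff_alpha_eq_0)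
  qed (simp add: f_def coeff_sum)
  have rec: "coeff (lame p (f k)) n
      = 8 * (of_nat (n + 1) * ([:[:1 / c:]:] * coeff (pCons 0 (alpha p (n + 1))) k))" for k n
    using coeff_alpha_rec[of n p k] unfolding coeff_lame cf by algebra
  show ?thesis
  proof (rule that[of f])
    show "\<forall>k n. n + k > p \<longrightarrow> coeff (f k) n = 0"
      by (simp add: cf coeff_alpha_eq_0)
    show "f p = 1"
    proof (rule poly_eqI)
      show "coeff (f p) n = coeff 1 n" for n
        using c by (cases n) (simp_all add: cf coeff_alpha_eq_0, simp add: one_pCons)
    qed
    show "coeff (f 0) p \<noteq> 0"
      using c(1) by (simp add: cf alpha.simps)
    show "lame p (f 0) = 0"
      by (rule poly_eqI) (simp add: rec)
    show "\<forall>k. lame p (f (Suc k)) = 8 * pderiv (f k)"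
      by (rule allI, rule poly_eqI) (simp only: rec coeff_numeral_mult coeff_pderiv cf coeff_pCons_Suc
          flip: Suc_eq_plus1)
  qed
qed

subsection \<open>The spectral polynomial\<close>

interpretation schroe: schroedinger DV "UV p" "abs_V (cV (1/2))" for p
proof
  have "2 * cV (1/2) = 1" by (simp add: cV_def numeral_poly one_pCons)
  hence "abs_V (2 * cV (1/2)) = 1" by (simp only: abs_V.h_1)
  thus "2 * abs_V (cV (1/2)) = 1" by (simp add: abs_V.h_mult)
qed

section \<open>Transfer of operators from R to V\<close>

lemma smult_sum_right: "smult c (sum f A) = (\<Sum>i\<in>A. smult c (f i))"
  using sum_distrib_left[of "[:c:]" f A] by simp

lemma opmul_eq: "opmul P Q = Dx.opm P Q"
  unfolding opmul_def Dx.opm_def Dx.dl_funpow smult_sum_right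
  by (simp add: mult.commute)

interpretation absp: rhom "map_poly abs_V"
  by (rule abs_V.rhom_map_poly)

lemma map_poly_opmul: "map_poly abs_V (opmul P Q) = DV.opm (map_poly abs_V P) (map_poly abs_V Q)"
proof -
  have "map_poly abs_V (Dx.dl Q) = DV.dl (map_poly abs_V Q)" for Q
    by (rule poly_eqI)
      (simp add: Dx.dl_def DV.dl_def coeff_map_poly abs_V.h_add DV.abs_eq coeff_pCons
        split: nat.split)
  hence "map_poly abs_V ((Dx.dl ^^ i) Q) = (DV.dl ^^ i) (map_poly abs_V Q)" for i
    by (induction i) simp_all
  thus ?thesis
    by (simp add: opmul_eq Dx.opm_def absp.h_sum abs_V.map_poly_smult coeff_map_poly
        DV.opm_bound[OF map_poly_degree_leq])
qed

lemma map_poly_opeval: "map_poly abs_V (opeval S L) = DV.opev (map_poly abs_V S) (map_poly abs_V L)"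
proof -
  have "map_poly abs_V (oppow L i) = (DV.opm (map_poly abs_V L) ^^ i) 1" for i
    by (induction i) (simp_all add: oppow_def map_poly_opmul)
  thus ?thesis
    by (simp add: opeval_def absp.h_sum abs_V.map_poly_smult coeff_map_poly
        DV.opev_bound[OF map_poly_degree_leq])
qed

lemma opeq_iff: "opeq P Q \<longleftrightarrow> map_poly abs_V P = map_poly abs_V Q"
  by (simp add: opeq_def veq_iff poly_eq_iff coeff_map_poly)

lemma UV_eq: "UV p = abs_V (cV (of_nat (p * (p + 1))) * wp)"
  unfolding UV_def UP_def iota_def cV_def wp_def of_nat_poly by simp

lemma map_poly_Lop: "map_poly abs_V (Lop p) = schroe.L p"
  unfolding schroe.L_def unfolding Lop_def UV_eq
  by (simp add: map_poly_pCons abs_V.h_minus abs_V.h_mult)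

lemma degree_lead_map_poly_abs_V:
  assumes "degree A = n" "lead_coeff A = 1"
  shows "degree (map_poly abs_V A) = n \<and> lead_coeff (map_poly abs_V A) = 1"
proof -
  have "degree (map_poly abs_V A) = n"
    using assms by (subst map_poly_degree_eq) simp_all
  thus ?thesis using assms by (simp add: coeff_map_poly)
qed

lemma abs_rep_V: "abs_V (rep_V v) = v"
  by (rule Quotient3_abs_rep[OF Quotient3_V])

text \<open>The top coefficient is lifted to 1 itself: \<open>rep_V 1\<close> is 1 only modulo
  \<open>rel\<close>, whereas \<open>spectral_poly\<close> asks for a leading coefficient equal to 1
  in R.\<close>

lemma monic_lift:
  assumes "degree A = n" "lead_coeff A = 1"
  obtains B where "map_poly abs_V B = A" "degree B = n" "lead_coeff B = 1"
proof
  define B where "B = (\<Sum>i<n. monom (rep_V (coeff A i)) i) + monom 1 n"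
  have cB: "coeff B i = (if i < n then rep_V (coeff A i) else if i = n then 1 else 0)" for i
    by (simp add: B_def coeff_sum)
  show "map_poly abs_V B = A"
    by (rule poly_eqI) (use assms in \<open>auto simp: coeff_map_poly cB abs_rep_V coeff_eq_0\<close>)
  show "degree B = n"
    by (rule antisym[OF degree_le le_degree]) (simp_all add: cB)
  thus "lead_coeff B = 1" by (simp add: cB)
qed

text \<open>The embedding of C[g2, g3], which by \<open>DV_eq_0\<close> is the full ring of
  constants of V.\<close>

definition kappa :: "complex poly poly \<Rightarrow> V" where
  "kappa c = iota [:c:]"

lemma kappa_0 [simp]: "kappa 0 = 0"
  by (simp add: kappa_def)

lemma kappa_eq_iff: "kappa c = kappa d \<longleftrightarrow> c = d"
  by (simp add: kappa_def iota_eq_iff)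

lemma emb1_0 [simp]: "emb1 0 = 0"
  by (simp add: emb1_def)

lemma map_poly_emb1: "map_poly abs_V (map_poly emb1 S) = map_poly kappa S"
  by (rule poly_eqI) (simp add: coeff_map_poly kappa_def iota_def emb1_def)

definition curve_eq :: "nat \<Rightarrow> V poly \<Rightarrow> V poly \<Rightarrow> bool" where
  "curve_eq p a S \<longleftrightarrow>
     4 * S = 4 * [:UV p, 1:] * a^2 - 2 * a * map_poly DV (map_poly DV a) + (map_poly DV a)^2"

text \<open>This is \<open>commuting_root_iff\<close> over V, carried back to R: monic operators
  stay monic in the quotient, and conversely they lift.\<close>

lemma spectral_poly_iff:
  "spectral_poly p S \<longleftrightarrow> lead_coeff S = 1 \<and> degree S = 2 * p + 1 \<and>
     (\<exists>a. degree a = p \<and> lead_coeff a = 1 \<and> lame_eq p a \<and> curve_eq p a (map_poly kappa S))"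
proof -
  have "(\<exists>A. degree A = 2 * p + 1 \<and> lead_coeff A = 1 \<and>
        opeq (opmul A (Lop p)) (opmul (Lop p) A) \<and>
        opeq (opmul A A) (opeval (map_poly emb1 S) (Lop p)))
    \<longleftrightarrow> (\<exists>A. degree A = 2 * p + 1 \<and> lead_coeff A = 1 \<and>
        DV.opm A (schroe.L p) = DV.opm (schroe.L p) A \<and>
        DV.opm A A = DV.opev (map_poly kappa S) (schroe.L p))" (is "(\<exists>A. ?P A) \<longleftrightarrow> (\<exists>A. ?Q A)")
  proof
    assume "\<exists>A. ?P A"
    then obtain A where A: "degree A = 2 * p + 1" "lead_coeff A = 1" "?P A" by blast
    have "degree (map_poly abs_V A) = 2 * p + 1" "lead_coeff (map_poly abs_V A) = 1"
      using degree_lead_map_poly_abs_V[OF A(1,2)] by auto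
    hence "?Q (map_poly abs_V A)"
      using A(3) by (simp only: opeq_iff map_poly_opmul map_poly_opeval map_poly_Lop map_poly_emb1)
    thus "\<exists>A. ?Q A" by blast
  next
    assume "\<exists>A. ?Q A"
    then obtain A where A: "degree A = 2 * p + 1" "lead_coeff A = 1" "?Q A" by blast
    obtain B where B: "map_poly abs_V B = A" "degree B = 2 * p + 1" "lead_coeff B = 1"
      by (rule monic_lift[OF A(1,2)])
    hence "?P B"
      using A(3)
      by (simp only: opeq_iff map_poly_opmul map_poly_opeval map_poly_Lop map_poly_emb1)
    thus "\<exists>A. ?P A" by blast
  qed
  thus ?thesis
    unfolding spectral_poly_def schroe.commuting_root_iff lame_eq_def curve_eq_def by blast
qed

text \<open>Two monic solutions of degree p differ by a solution of degree below p in \<lambda>,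
  which is 0. The curve equation then determines S.\<close>

lemma spectral_poly_unique:
  assumes "spectral_poly p S" "spectral_poly p T"
  shows "S = T"
proof -
  obtain a b where a: "degree a = p" "lead_coeff a = 1" "lame_eq p a" "curve_eq p a (map_poly kappa S)"
    and b: "degree b = p" "lead_coeff b = 1" "lame_eq p b" "curve_eq p b (map_poly kappa T)"
    using assms by (auto simp: spectral_poly_iff)
  have "coeff (a - b) k = 0" if "k \<ge> p" for k
    using a b that by (cases "k = p") (auto simp: coeff_eq_0)
  hence "a - b = 0" using lame_eq_low_degree[OF lame_eq_diff[OF a(3) b(3)]] by blast
  hence "4 * map_poly kappa S = 4 * map_poly kappa T"
    using a(4) b(4) by (simp add: curve_eq_def)
  hence "map_poly kappa S = map_poly kappa T" by simp
  thus ?thesis by (simp add: poly_eq_iff coeff_map_poly kappa_eq_iff)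
qed

lemma DV_eq_0:
  assumes "DV v = 0"
  obtains c where "v = kappa c"
proof -
  have "1 * DV v = yV * iota 0" using assms by simp
  then obtain f where "v = iota f" "1 * pderiv f = 0"
    by (metis DV_eq_iota Num.numeral_One)
  moreover from this obtain c where "f = [:c:]" using pderiv_iszero by auto
  ultimately show ?thesis using that by (simp add: kappa_def)
qed

lemma Sp_props:
  obtains a f where "spectral_poly p (Sp p)" "degree a = p" "lead_coeff a = 1"
    "curve_eq p a (map_poly kappa (Sp p))" "\<forall>k. coeff a k = iota (f k)"
    "\<forall>k n. n + k > p \<longrightarrow> coeff (f k) n = 0" "coeff (f 0) p \<noteq> 0"
proof -
  obtain f where f: "f p = 1" "\<forall>k n. n + k > p \<longrightarrow> coeff (f k) n = 0" "coeff (f 0) p \<noteq> 0"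
    "lame p (f 0) = 0" "\<forall>k. lame p (f (Suc k)) = 8 * pderiv (f k)"
    by (rule lame_eq_exists[of p])
  define a where "a = (\<Sum>k\<le>p. monom (iota (f k)) k)"
  have "f k = 0" if "k > p" for k by (rule poly_eqI) (use f(2) that in simp)
  hence ca: "coeff a k = iota (f k)" for k
    by (cases "k \<le> p") (simp_all add: a_def coeff_sum)
  have deg: "degree a = p"
  proof (rule antisym[OF degree_le le_degree])
    show "\<forall>i>p. coeff a i = 0" by (simp add: ca \<open>\<And>k. k > p \<Longrightarrow> f k = 0\<close>)
  qed (simp add: ca f(1))
  have lead: "lead_coeff a = 1" by (simp add: deg ca f(1))
  have lame: "lame_eq p a"
    unfolding lame_eq_iff
  proof
    fix k
    show "2 * DV (DV (DV (coeff a k))) - 8 * UV p * DV (coeff a k) - 4 * DV (UV p) * coeff a k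
        = 8 * (case k of 0 \<Rightarrow> 0 | Suc j \<Rightarrow> DV (coeff a j))"
      unfolding ca lame_iota[symmetric]
      by (cases k) (simp_all add: f(4,5) iota.h_mult DV_iota)
  qed
  let ?d = "map_poly DV"
  define T where "T = 4 * [:UV p, 1:] * a^2 - 2 * a * ?d (?d a) + (?d a)^2"
  have dX: "?d [:UV p, 1:] = [:DV (UV p):]" by (simp add: map_poly_pCons)
  \<comment> \<open>T is a first integral: its derivative is a multiple of the linear equation. Its
    coefficients are therefore constants, and T/4 will be the spectral polynomial.\<close>
  have "?d T = 2 * a * (4 * [:UV p, 1:] * ?d a + 2 * [:DV (UV p):] * a - ?d (?d (?d a)))"
    unfolding T_def power2_eq_square schroe.dp.D_add schroe.dp.D_diff schroe.dp.D_mult dX schroe.dp.D_numeral by algebra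
  also have "\<dots> = 0" using lame unfolding lame_eq_def by simp
  finally have "?d T = 0" .
  hence "DV (coeff T k) = 0" for k
    by (metis coeff_map_poly DV.D_0 coeff_0)
  hence "\<forall>k. \<exists>c. coeff T k = kappa c" by (metis DV_eq_0)
  then obtain t where t: "\<And>k. coeff T k = kappa (t k)" by metis
  have dega: "degree (?d a) \<le> p" "degree (?d (?d a)) \<le> p"
    using map_poly_degree_leq[of DV a] map_poly_degree_leq[of DV "?d a"] deg by simp_all
  \<comment> \<open>The derivative terms have degree at most 2p in \<lambda>, so the leading term of
    T is that of 4 (\<lambda> + U) a^2.\<close>
  define E where "E = (?d a)^2 - 2 * a * ?d (?d a)"
  have "degree (a * ?d (?d a)) \<le> 2 * p" "degree (?d a * ?d a) \<le> 2 * p"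
    using degree_mult_le[of a "?d (?d a)"] degree_mult_le[of "?d a" "?d a"] dega deg by simp_all
  hence E: "coeff E k = 0" if "k > 2 * p" for k
    using that by (simp add: E_def power2_eq_square mult.assoc coeff_numeral_mult coeff_eq_0)
  define M where "M = [:UV p, 1:] * a^2"
  have "a \<noteq> 0" using lead by auto
  hence M: "degree M = 2 * p + 1" "lead_coeff M = 1"
  proof -
    show "degree M = 2 * p + 1"
      using \<open>a \<noteq> 0\<close>
      by (simp add: M_def degree_mult_eq degree_power_eq deg del: mult_pCons_left)
    show "lead_coeff M = 1"
      by (simp only: M_def lead_coeff_mult lead_coeff_power lead) simp
  qed
  have T: "T = 4 * M + E" unfolding T_def M_def E_def by algebra
  have cT: "coeff T (2 * p + 1) = 4" "\<And>k. k > 2 * p + 1 \<Longrightarrow> coeff T k = 0"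
    using M E by (simp_all add: T coeff_numeral_mult coeff_eq_0)
  define S where "S = (\<Sum>k\<le>2 * p + 1. monom ([:[:1/4:]:] * t k) k)"
  have four: "4 * kappa ([:[:1/4:]:] * c) = kappa c" for c
  proof -
    have "4 * kappa ([:[:1/4:]:] * c) = iota (4 * [:[:[:1/4:]:] * c:])"
      by (simp only: kappa_def iota.h_mult iota.h_numeral)
    also have "4 * [:[:[:1/4:]:] * c:] = [:c:]"
      by (simp add: numeral_poly flip: one_pCons)
    finally show ?thesis by (simp add: kappa_def)
  qed
  have tk: "t k = 0" if "k > 2 * p + 1" for k
    using cT(2)[OF that] t[of k] kappa_eq_iff[of "t k" 0] by simp
  have cS: "coeff S k = [:[:1/4:]:] * t k" for k
    by (cases "k \<le> 2 * p + 1") (simp_all add: S_def coeff_sum tk)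
  have 4: "4 * map_poly kappa S = T"
    by (rule poly_eqI) (simp only: coeff_numeral_mult coeff_map_poly kappa_0 cS four t)
  have "kappa (t (2 * p + 1)) = kappa 4"
  proof -
    have "kappa 4 = 4" by (simp add: kappa_def flip: numeral_poly)
    thus ?thesis using cT(1) t[of "2 * p + 1"] by simp
  qed
  hence "t (2 * p + 1) = 4" by (simp only: kappa_eq_iff)
  hence S1: "coeff S (2 * p + 1) = 1"
    by (simp only: cS) (simp add: numeral_poly one_pCons)
  have degS: "degree S = 2 * p + 1"
  proof (rule antisym[OF degree_le le_degree])
    show "\<forall>i>2 * p + 1. coeff S i = 0" using tk by (auto simp: cS)
  qed (simp only: S1, simp)
  have curve: "curve_eq p a (map_poly kappa S)"
    unfolding curve_eq_def 4 T_def ..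
  have S: "spectral_poly p S"
    unfolding spectral_poly_iff using degS S1 deg lead lame curve by auto
  hence "Sp p = S"
    unfolding Sp_def by (intro the_equality spectral_poly_unique)
  thus ?thesis
    using that[of a f] S deg lead curve ca f(2,3) by simp
qed

subsection \<open>The series b\<close>

interpretation ricc: riccati DV "UV p" for p ..

interpretation absf: rhom "fps_map abs_V"
  by (rule abs_V.rhom_fps_map)

lemma fveq_iff: "fveq f g \<longleftrightarrow> fps_map abs_V f = fps_map abs_V g"
  by (simp add: fveq_def veq_iff fps_eq_iff)

lemma fps_map_fDx: "fps_map abs_V (fDx b) = fps_map DV (fps_map abs_V b)"
  by (rule fps_ext) (simp add: fDx_def DV.abs_eq)

lemma fps_map_abs_V_const: "fps_map abs_V (fps_const c) = fps_const (abs_V c)"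
  and fps_map_abs_V_X: "fps_map abs_V fps_X = fps_X"
  by (rule fps_ext, simp add: fps_X_def)+

text \<open>Since C = -p(p+1)/2, the term -2 C \<wp> is U. Doubling the equation removes the factor
  1/2.\<close>

lemma b_eq_iff: "b_eq p b \<longleftrightarrow> fps_map abs_V b $ 0 = 1 \<and> ricc.ric p (fps_map abs_V b) = - 4"
proof -
  define B H where "B = fps_map abs_V b" and "H = fps_const (abs_V (cV (1/2)))"
  have H: "2 * H = 1"
    using schroe.half by (simp add: H_def numeral_fps_const mult.commute)
  have "cV (2 * Cp p) = - cV (of_nat (p * (p + 1)))"
    by (simp add: Cp_def cV_def)
  hence "abs_V (cV (2 * Cp p) * wp) = - UV p"
    by (simp only: UV_eq mult_minus_left abs_V.h_minus)
  hence U: "fps_const (abs_V (cV (2 * Cp p) * wp)) = - fps_const (UV p)" by simp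
  have "fveq (fps_X * (b * fDx (fDx b) - fps_const (cV (1/2)) * (fDx b)^2)
           - 2 * (1 - fps_const (cV (2 * Cp p) * wp) * fps_X) * b^2) (- 2)
     \<longleftrightarrow> fps_X * (B * fps_map DV (fps_map DV B) - H * (fps_map DV B)^2)
           - 2 * (1 - - fps_const (UV p) * fps_X) * B^2 = - 2"
    by (simp only: fveq_iff absf.h_diff absf.h_mult absf.h_add absf.h_power absf.h_minus absf.h_1
        absf.h_numeral fps_map_fDx fps_map_abs_V_const fps_map_abs_V_X U B_def H_def)
  also have "\<dots> \<longleftrightarrow> 2 * (fps_X * (B * fps_map DV (fps_map DV B) - H * (fps_map DV B)^2)
           - 2 * (1 - - fps_const (UV p) * fps_X) * B^2) = 2 * (- 2)"
    by (simp only: mult_cancel_left) simp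
  also have "2 * (fps_X * (B * fps_map DV (fps_map DV B) - H * (fps_map DV B)^2)
           - 2 * (1 - - fps_const (UV p) * fps_X) * B^2) = ricc.ric p B"
    unfolding ricc.ric_def using H by algebra
  finally show ?thesis by (simp add: b_eq_def veq_iff B_def)
qed

text \<open>For constant q, both b q and f solve \<open>ric\<close> = -4 q^2 with the same nonzero
  constant term.\<close>

lemma b_unique:
  assumes "b_eq p b" "fps_map DV q = 0" "ricc.ric p f = - 4 * (q * q)" "f $ 0 = q $ 0" "q $ 0 \<noteq> 0"
  shows "fps_map abs_V b * q = f"
proof (rule ricc.ric_unique)
  have b: "fps_map abs_V b $ 0 = 1" "ricc.ric p (fps_map abs_V b) = - 4"
    using assms(1) by (simp_all only: b_eq_iff)
  show "ricc.ric p (fps_map abs_V b * q) = ricc.ric p f"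
    by (simp add: ricc.ric_mult_const[OF assms(2)] b assms(3) power2_eq_square)
  show "(fps_map abs_V b * q) $ 0 = f $ 0" "(fps_map abs_V b * q) $ 0 \<noteq> 0"
    using b assms(4,5) by simp_all
qed

text \<open>The solution is f/q with its coefficients lifted to R. The inverse of the constant q is
  again constant.\<close>

lemma b_exists:
  assumes "fps_map DV q = 0" "ricc.ric p f = - 4 * (q * q)" "f $ 0 = 1" "q $ 0 = 1"
  shows "\<exists>b. b_eq p b"
proof -
  define r where "r = fps_right_inverse q 1"
  have qr: "q * r = 1" unfolding r_def by (rule fps_right_inverse) (simp add: assms(4))
  have "fps_map DV (q * r) = 0" by (simp only: qr ricc.df.D_1)
  hence "q * fps_map DV r = 0" by (simp add: ricc.df.D_mult assms(1))
  moreover have "q \<noteq> 0" using assms(4) by auto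
  ultimately have Dr: "fps_map DV r = 0" by simp
  define b where "b = fps_map rep_V (f * r)"
  have b: "fps_map abs_V b = f * r"
    by (rule fps_ext) (simp add: b_def abs_rep_V)
  have "ricc.ric p (f * r) = - 4 * ((q * r) * (q * r))"
    by (simp add: ricc.ric_mult_const[OF Dr] assms(2) power2_eq_square mult_ac)
  hence "b_eq p b"
    by (simp add: b_eq_iff b qr) (simp add: assms(3) r_def)
  thus ?thesis ..
qed

lemma rsqrt_const:
  assumes P: "lead_coeff P = cV (c^2)" "Re c > 0" and D: "\<And>i. Dx (coeff P i) = 0"
  shows "fps_map DV (fps_map abs_V (rsqrt P)) = 0" "fps_map abs_V (rsqrt P) $ 0 = abs_V (cV c)"
    "fps_map abs_V (rsqrt P) * fps_map abs_V (rsqrt P)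
       = fps_map abs_V (fps_of_poly (reflect_poly P))"
proof -
  interpret f: derivation fDx
    using Dx.derivation_fps_map by (simp add: fDx_def fps_map_def[abs_def] derivation_def)
  note s = rsqrt_props[OF P]
  have "c \<noteq> 0" using P(2) by auto
  hence "rsqrt P \<noteq> 0" using s(2) by (auto simp: cV_def)
  have "fDx (rsqrt P) = 0"
  proof (rule f.D_root_eq_0)
    show "fDx (rsqrt P * rsqrt P) = 0"
      by (rule fps_ext) (simp add: s(1) fDx_def coeff_reflect_poly D)
  qed (use \<open>rsqrt P \<noteq> 0\<close> in simp)
  thus "fps_map DV (fps_map abs_V (rsqrt P)) = 0"
    by (simp flip: fps_map_fDx)
  show "fps_map abs_V (rsqrt P) $ 0 = abs_V (cV c)"
    by (simp add: s(2))
  show "fps_map abs_V (rsqrt P) * fps_map abs_V (rsqrt P)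
       = fps_map abs_V (fps_of_poly (reflect_poly P))"
    by (simp add: s(1) flip: absf.h_mult)
qed

text \<open>Reduces a closed form to one identity for \<open>ric\<close>, without reference to
  \<open>Sp\<close>. The constant c is the root of the leading coefficient of P, so P need not be
  made monic.\<close>

lemma b_closed_form:
  assumes "b_eq p b" and P: "lead_coeff P = cV (c^2)" "Re c > 0" "\<And>i. Dx (coeff P i) = 0"
    and f: "ricc.ric p (fps_map abs_V f) = - 4 * fps_map abs_V (fps_of_poly (reflect_poly P))"
      "f $ 0 = cV c"
  shows "fveq (b * rsqrt P) f"
proof -
  have "c \<noteq> 0" using P(2) by auto
  hence "abs_V (cV c) \<noteq> 0"
    using iota_eq_iff[of "[:[:[:c:]:]:]" 0] by (simp add: iota_def cV_def)
  thus ?thesis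
    using b_unique[OF assms(1) rsqrt_const(1)[OF P], of "fps_map abs_V f"] rsqrt_const(2,3)[OF P] f
    by (simp add: fveq_iff absf.h_mult)
qed

lemma Dx_emb1 [simp]: "Dx (emb1 c) = 0"
  by (simp add: Dx_eq emb1_def map_poly_pCons)

lemma map_poly_emb1_props:
  shows "lead_coeff (map_poly emb1 S) = emb1 (lead_coeff S)"
    "fps_map abs_V (fps_of_poly (reflect_poly (map_poly emb1 S)))
       = fps_of_poly (reflect_poly (map_poly kappa S))"
proof -
  have d: "degree (map_poly emb1 S) = degree S" "degree (map_poly kappa S) = degree S"
    by (rule degree_map_poly; simp add: emb1_def kappa_eq_iff[of _ 0, simplified])+
  show "lead_coeff (map_poly emb1 S) = emb1 (lead_coeff S)"
    by (simp add: d coeff_map_poly)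
  show "fps_map abs_V (fps_of_poly (reflect_poly (map_poly emb1 S)))
       = fps_of_poly (reflect_poly (map_poly kappa S))"
    by (rule fps_ext)
      (simp add: coeff_reflect_poly d coeff_map_poly kappa_def iota_def emb1_def)
qed

lemma b_general:
  obtains a f where "\<exists>b. b_eq p b"
    "\<And>b. b_eq p b \<Longrightarrow>
       fps_map abs_V (rsqrt (map_poly emb1 (Sp p)) * b) = fps_of_poly (reflect_poly a)"
    "degree a = p" "lead_coeff a = 1" "\<forall>k. coeff a k = iota (f k)"
    "\<forall>k n. n + k > p \<longrightarrow> coeff (f k) n = 0" "coeff (f 0) p \<noteq> 0"
proof -
  obtain a f where S: "spectral_poly p (Sp p)" and a: "degree a = p" "lead_coeff a = 1"
    "curve_eq p a (map_poly kappa (Sp p))" "\<forall>k. coeff a k = iota (f k)"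
    "\<forall>k n. n + k > p \<longrightarrow> coeff (f k) n = 0" "coeff (f 0) p \<noteq> 0"
    by (rule Sp_props[of p])
  define P where "P = map_poly emb1 (Sp p)"
  have Sd: "lead_coeff (Sp p) = 1" "degree (Sp p) = 2 * p + 1"
    using S unfolding spectral_poly_def by blast+
  have e1: "emb1 1 = cV (1^2)" by (simp add: emb1_def cV_def flip: one_pCons)
  have P: "lead_coeff P = cV (1^2)" "Re 1 > 0" "\<And>i. Dx (coeff P i) = 0"
    unfolding P_def map_poly_emb1_props Sd(1) e1 by (simp_all add: coeff_map_poly)
  define q where "q = fps_map abs_V (rsqrt P)"
  have q: "fps_map DV q = 0" "q $ 0 = 1"
      "q * q = fps_of_poly (reflect_poly (map_poly kappa (Sp p)))"
    using rsqrt_const[OF P] e1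
    by (simp_all add: q_def P_def map_poly_emb1_props cV_def flip: one_pCons)
  have degS: "degree (map_poly kappa (Sp p)) = 2 * p + 1"
    by (subst degree_map_poly) (simp_all only: kappa_eq_iff[of _ 0, simplified] Sd not_False_eq_True)
  have r: "ricc.ric p (fps_of_poly (reflect_poly a)) = - 4 * (q * q)"
    unfolding q(3) using a(3)[unfolded curve_eq_def] by (rule ricc.ric_reflect[OF a(1) degS])
  have r0: "fps_of_poly (reflect_poly a) $ 0 = 1" using a(2) by simp
  show ?thesis
  proof (rule that[OF _ _ a(1,2,4,5,6)])
    show "\<exists>b. b_eq p b"
      by (rule b_exists[OF q(1) r r0 q(2)])
    show "fps_map abs_V (rsqrt (map_poly emb1 (Sp p)) * b) = fps_of_poly (reflect_poly a)"
      if "b_eq p b" for b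
      using b_unique[OF that q(1) r] r0 q(2)
      by (simp add: absf.h_mult q_def P_def mult.commute)
  qed
qed

subsection \<open>Closed forms for small p\<close>

definition cf :: "R \<Rightarrow> V fps" where
  "cf c = fps_const (abs_V c)"

interpretation cf: rhom cf
  by standard (simp_all add: cf_def abs_V.h_add abs_V.h_mult)

lemma fps_map_abs_V_pCons:
  "fps_map abs_V (fps_of_poly (pCons c q)) = cf c + fps_map abs_V (fps_of_poly q) * fps_X"
  by (simp add: fps_of_poly_pCons absf.h_add absf.h_mult fps_map_abs_V_const fps_map_abs_V_X cf_def)

lemma fps_map_DV_cf: "fps_map DV (cf c) = cf (Dx c)"
  by (rule fps_ext) (simp add: cf_def DV.abs_eq)

lemma Dx_basic [simp]: "Dx g2 = 0" "Dx g3 = 0" "Dx wp = wp'" "2 * Dx wp' = 12 * wp^2 - g2"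
proof -
  have "2 * (6 * wp^2 - cV (1/2) * g2) = 12 * wp^2 - (2 * cV (1/2)) * g2"
    by (simp add: algebra_simps)
  moreover have "2 * cV (1/2) = 1" by (simp add: cV_def numeral_poly one_pCons)
  moreover have "Dx wp' = 6 * wp^2 - cV (1/2) * g2"
    by (simp add: Dx_def wp'_def map_poly_pCons pderiv_pCons)
  ultimately show "2 * Dx wp' = 12 * wp^2 - g2" by simp
  show "Dx g2 = 0" "Dx g3 = 0" "Dx wp = wp'"
    by (simp_all add: Dx_eq g2_def g3_def wp_def map_poly_pCons pderiv_pCons flip: one_pCons)
qed

lemma cf_wp'_square: "cf wp' ^ 2 = 4 * cf wp ^ 3 - cf g2 * cf wp - cf g3"
proof -
  have "veq (wp'^2) (4 * wp^3 - g2 * wp - g3)" by (simp add: veq_def rel_def algebra_simps)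
  hence "cf (wp'^2) = cf (4 * wp^3 - g2 * wp - g3)" by (simp add: cf_def veq_iff)
  thus ?thesis by (simp add: cf.h_diff cf.h_mult cf.h_power)
qed

lemma fps_map_DV_cf_basic:
  "fps_map DV (cf wp) = cf wp'" "fps_map DV (cf g2) = 0" "fps_map DV (cf g3) = 0"
  "2 * fps_map DV (cf wp') = 12 * cf wp ^ 2 - cf g2" "fps_map DV fps_X = 0"
proof -
  have "2 * fps_map DV (cf wp') = cf (2 * Dx wp')" by (simp only: fps_map_DV_cf cf.h_mult cf.h_numeral)
  thus "2 * fps_map DV (cf wp') = 12 * cf wp ^ 2 - cf g2"
    by (simp add: cf.h_diff cf.h_mult cf.h_power)
  show "fps_map DV fps_X = 0" by (rule fps_ext) (simp add: fps_X_def)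
qed (simp_all add: fps_map_DV_cf)

lemma fps_const_UV: "fps_const (UV p) = of_nat (p * (p + 1)) * cf wp"
proof -
  have "cV (of_nat n) = of_nat n" for n by (simp add: cV_def of_nat_poly)
  hence "fps_const (UV p) = cf (of_nat (p * (p + 1)) * wp)" by (simp only: UV_eq cf_def)
  thus ?thesis by (simp only: cf.h_mult cf.h_of_nat)
qed

text \<open>For f polynomial in \<wp>, g and h are its first and second derivatives in \<wp>, and
  f_xx = \<wp>'' g + \<wp>'^2 h. The curve relation removes \<wp>', leaving a polynomial identity in
  \<wp>, g2, g3 and \<open>fps_X\<close>.\<close>

lemma ric_even:
  fixes f g h :: "V fps"
  assumes "fps_map DV f = cf wp' * g" "fps_map DV g = cf wp' * h"
  shows "ricc.ric p f
      = fps_X * (f * ((12 * cf wp ^ 2 - cf g2) * g + 2 * (4 * cf wp ^ 3 - cf g2 * cf wp - cf g3) * h)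
                 - (4 * cf wp ^ 3 - cf g2 * cf wp - cf g3) * g^2)
        - 4 * (1 + of_nat (p * (p + 1)) * cf wp * fps_X) * f^2"
proof -
  have "fps_map DV (fps_map DV f) = fps_map DV (cf wp') * g + cf wp' ^ 2 * h"
    by (simp add: assms ricc.df.D_mult power2_eq_square mult.assoc)
  hence "2 * fps_map DV (fps_map DV f)
      = 2 * fps_map DV (cf wp') * g + 2 * cf wp' ^ 2 * h"
    by (simp add: distrib_left mult.assoc)
  hence f2: "2 * fps_map DV (fps_map DV f)
      = (12 * cf wp ^ 2 - cf g2) * g + 2 * (4 * cf wp ^ 3 - cf g2 * cf wp - cf g3) * h"
    by (simp only: fps_map_DV_cf_basic cf_wp'_square)
  have f1: "(fps_map DV f)^2 = (4 * cf wp ^ 3 - cf g2 * cf wp - cf g3) * g^2"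
    by (simp only: assms power_mult_distrib cf_wp'_square)
  have "ricc.ric p f = fps_X * (f * (2 * fps_map DV (fps_map DV f)) - (fps_map DV f)^2)
      - 4 * (1 + fps_const (UV p) * fps_X) * f^2"
    unfolding ricc.ric_def by algebra
  thus ?thesis by (simp only: f1 f2 fps_const_UV)
qed

lemma cV_numeral: "cV (numeral k) = numeral k"
  by (simp add: cV_def numeral_poly)

lemma b_closed_form_1:
  assumes "b_eq 1 b"
  shows "fveq (b * rsqrt (4 * lam^3 - cst g2 * lam - cst g3))
                (fps_const 2 * fps_of_poly (reflect_poly (lam - cst wp)))"
proof -
  define P where "P = [:- g3, - g2, 0, 4:]"
  have P: "4 * lam^3 - cst g2 * lam - cst g3 = P"
    by (simp add: P_def lam_def cst_def numeral_poly power3_eq_cube)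
  have rP: "reflect_poly P = [:4, 0, - g2, - g3:]"
    by (simp add: P_def reflect_poly_def)
  have f: "lam - cst wp = [:- wp, 1:]" by (simp add: lam_def cst_def)
  have rf: "reflect_poly (lam - cst wp) = [:1, - wp:]"
    unfolding f by (simp add: reflect_poly_def)
  show ?thesis
    unfolding P rf
  \<comment> \<open>The value 2 is the root of the leading coefficient 4 of P.\<close>
  proof (rule b_closed_form[OF assms, of _ 2])
    show "lead_coeff P = cV (2^2)" "0 < Re 2"
      by (simp_all add: P_def cV_numeral)
    show "Dx (coeff P i) = 0" for i
      by (simp add: P_def coeff_pCons Dx.D_minus split: nat.split)
    show "(fps_const 2 * fps_of_poly [:1, - wp:]) $ 0 = cV 2"
      by (simp add: cV_numeral)
    have F: "fps_map abs_V (fps_const 2 * fps_of_poly [:1, - wp:]) = 2 - 2 * cf wp * fps_X"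
      by (simp add: absf.h_mult fps_map_abs_V_pCons cf.h_minus flip: numeral_fps_const)
    have R: "fps_map abs_V (fps_of_poly (reflect_poly P))
        = 4 - cf g2 * fps_X^2 - cf g3 * fps_X^3"
      unfolding rP fps_map_abs_V_pCons cf.h_minus cf.h_numeral cf.h_0
      by (simp add: absf.h_0 power2_eq_square power3_eq_cube algebra_simps)
    show "ricc.ric 1 (fps_map abs_V (fps_const 2 * fps_of_poly [:1, - wp:]))
      = - 4 * fps_map abs_V (fps_of_poly (reflect_poly P))"
      unfolding F R
    proof (subst ric_even)
      show "fps_map DV (2 - 2 * cf wp * fps_X) = cf wp' * (- 2 * fps_X)"
        "fps_map DV (- 2 * fps_X) = cf wp' * 0"
        by (simp_all add: ricc.df.D_diff ricc.df.D_minus ricc.df.D_mult fps_map_DV_cf_basic)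
    qed (simp, algebra)
  qed
qed

lemma b_closed_form_2:
  assumes "b_eq 2 b"
  shows "fveq (b * rsqrt ((lam^2 - cst (3 * g2)) * (4 * lam^3 - cst (9 * g2) * lam + cst (27 * g3))))
                (fps_const (cV (1/2)) * fps_of_poly (reflect_poly
                   (4 * lam^2 - cst (12 * wp) * lam + cst (36 * wp^2 - 9 * g2))))"
proof -
  define P where "P = [:- (81 * g2 * g3), 27 * g2^2, 27 * g3, - (21 * g2), 0, 4:]"
  have P: "(lam^2 - cst (3 * g2)) * (4 * lam^3 - cst (9 * g2) * lam + cst (27 * g3)) = P"
  proof -
    have "21 * g2 = 12 * g2 + 9 * g2" by simp
    thus ?thesis
      unfolding P_def
      by (simp add: lam_def cst_def numeral_poly power2_eq_square power3_eq_cube mult.commute)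
  qed
  have rP: "reflect_poly P = [:4, 0, - (21 * g2), 27 * g3, 27 * g2^2, - (81 * g2 * g3):]"
    by (simp add: P_def reflect_poly_def)
  have f: "4 * lam^2 - cst (12 * wp) * lam + cst (36 * wp^2 - 9 * g2)
      = [:36 * wp^2 - 9 * g2, - (12 * wp), 4:]"
    by (simp add: lam_def cst_def numeral_poly power2_eq_square)
  have rf: "reflect_poly (4 * lam^2 - cst (12 * wp) * lam + cst (36 * wp^2 - 9 * g2))
      = [:4, - (12 * wp), 36 * wp^2 - 9 * g2:]"
    unfolding f by (simp add: reflect_poly_def)
  define F where "F = 4 - 12 * cf wp * fps_X + (36 * cf wp^2 - 9 * cf g2) * fps_X^2"
  have half: "2 * cV (1/2) = 1" "4 * cV (1/2) = cV 2"
    by (simp_all add: cV_def numeral_poly one_pCons)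
  hence H: "2 * cf (cV (1/2)) = 1"
    by (metis cf.h_1 cf.h_mult cf.h_numeral)
  show ?thesis
    unfolding P rf
  proof (rule b_closed_form[OF assms, of _ 2])
    show "lead_coeff P = cV (2^2)" "0 < Re 2"
      by (simp_all add: P_def cV_numeral)
    show "Dx (coeff P i) = 0" for i
      by (simp add: P_def coeff_pCons Dx.D_minus Dx.D_mult power2_eq_square split: nat.split)
    show "(fps_const (cV (1/2)) * fps_of_poly [:4, - (12 * wp), 36 * wp^2 - 9 * g2:]) $ 0 = cV 2"
      by (simp add: half mult.commute)
    have F: "fps_map abs_V (fps_const (cV (1/2)) * fps_of_poly [:4, - (12 * wp), 36 * wp^2 - 9 * g2:])
        = F * cf (cV (1/2))"
      unfolding F_def absf.h_mult fps_map_abs_V_pCons fps_map_abs_V_const fps_of_poly_0 absf.h_0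
        cf_def[symmetric] cf.h_diff cf.h_minus cf.h_mult cf.h_power cf.h_numeral
      by algebra
    have R: "fps_map abs_V (fps_of_poly (reflect_poly P))
        = 4 - 21 * cf g2 * fps_X^2 + 27 * cf g3 * fps_X^3 + 27 * cf g2^2 * fps_X^4
          - 81 * cf g2 * cf g3 * fps_X^5"
      unfolding rP fps_map_abs_V_pCons fps_of_poly_0 absf.h_0
        cf.h_diff cf.h_minus cf.h_mult cf.h_power cf.h_numeral cf.h_0
      by algebra
    \<comment> \<open>\<open>F\<close> omits the prefactor 1/2, whose square turns -16 into -4
      below.\<close>
    have "ricc.ric 2 F = - 16 * (4 - 21 * cf g2 * fps_X^2 + 27 * cf g3 * fps_X^3
        + 27 * cf g2^2 * fps_X^4 - 81 * cf g2 * cf g3 * fps_X^5)"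
    proof (subst ric_even)
      show "fps_map DV F = cf wp' * (- 12 * fps_X + 72 * cf wp * fps_X^2)"
        unfolding F_def power2_eq_square ricc.df.D_diff ricc.df.D_add ricc.df.D_minus
          ricc.df.D_mult fps_map_DV_cf_basic ricc.df.D_numeral by algebra
      show "fps_map DV (- 12 * fps_X + 72 * cf wp * fps_X^2) = cf wp' * (72 * fps_X^2)"
        unfolding power2_eq_square ricc.df.D_diff ricc.df.D_add ricc.df.D_minus
          ricc.df.D_mult fps_map_DV_cf_basic ricc.df.D_numeral by (simp add: ricc.df.D_minus)
    qed (simp add: F_def, algebra)
    moreover have "fps_map DV (cf (cV (1/2))) = 0"
      by (simp add: fps_map_DV_cf Dx_eq cV_def map_poly_pCons)
    ultimately show "ricc.ric 2 (fps_map abs_V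
          (fps_const (cV (1/2)) * fps_of_poly [:4, - (12 * wp), 36 * wp^2 - 9 * g2:]))
      = - 4 * fps_map abs_V (fps_of_poly (reflect_poly P))"
      unfolding F R ricc.ric_mult_const[OF \<open>fps_map DV (cf (cV (1/2))) = 0\<close>]
      using H by algebra
  qed
qed

lemma b_closed_form_3:
  assumes "b_eq 3 b"
  shows "fveq (b * rsqrt (16 * lam^6 - cst (504 * g2) * lam^4 + cst (2376 * g3) * lam^3
                   + cst (4185 * g2^2) * lam^2 - cst (36450 * g2 * g3) * lam
                   - cst (3375 * g2^3) + cst (91125 * g3^2)))
                (fps_of_poly (reflect_poly
                   (4 * lam^3 - cst (24 * wp) * lam^2 + cst (60 * (3 * wp^2 - g2)) * lam
                    - cst (900 * wp^3) + cst (225 * g2 * wp) + cst (225 * g3))))"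
proof -
  define P where "P = [:- (3375 * g2^3) + 91125 * g3^2, - (36450 * g2 * g3), 4185 * g2^2, 2376 * g3,
    - (504 * g2), 0, 16:]"
  have P: "16 * lam^6 - cst (504 * g2) * lam^4 + cst (2376 * g3) * lam^3
                   + cst (4185 * g2^2) * lam^2 - cst (36450 * g2 * g3) * lam
                   - cst (3375 * g2^3) + cst (91125 * g3^2) = P"
    by (simp add: P_def lam_def cst_def numeral_poly eval_nat_numeral)
  have rP: "reflect_poly P = [:16, 0, - (504 * g2), 2376 * g3, 4185 * g2^2, - (36450 * g2 * g3),
      - (3375 * g2^3) + 91125 * g3^2:]"
    by (simp add: P_def reflect_poly_def)
  have f: "4 * lam^3 - cst (24 * wp) * lam^2 + cst (60 * (3 * wp^2 - g2)) * lam
                    - cst (900 * wp^3) + cst (225 * g2 * wp) + cst (225 * g3)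
      = [:- (900 * wp^3) + 225 * g2 * wp + 225 * g3, 60 * (3 * wp^2 - g2), - (24 * wp), 4:]"
    by (simp add: lam_def cst_def numeral_poly eval_nat_numeral)
  have rf: "reflect_poly (4 * lam^3 - cst (24 * wp) * lam^2 + cst (60 * (3 * wp^2 - g2)) * lam
                    - cst (900 * wp^3) + cst (225 * g2 * wp) + cst (225 * g3))
      = [:4, - (24 * wp), 60 * (3 * wp^2 - g2), - (900 * wp^3) + 225 * g2 * wp + 225 * g3:]"
    unfolding f by (simp add: reflect_poly_def)
  define F where "F = 4 - 24 * cf wp * fps_X + (180 * cf wp^2 - 60 * cf g2) * fps_X^2
    + (- 900 * cf wp^3 + 225 * cf g2 * cf wp + 225 * cf g3) * fps_X^3"
  show ?thesis
    unfolding P rf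
  proof (rule b_closed_form[OF assms, of _ 4])
    show "lead_coeff P = cV (4^2)" "0 < Re 4"
      by (simp_all add: P_def cV_numeral)
    show "Dx (coeff P i) = 0" for i
      by (simp add: P_def coeff_pCons Dx.D_add Dx.D_diff Dx.D_minus Dx.D_mult eval_nat_numeral
          split: nat.split)
    show "fps_of_poly [:4, - (24 * wp), 60 * (3 * wp^2 - g2), - (900 * wp^3) + 225 * g2 * wp + 225 * g3:]
        $ 0 = cV 4"
      by (simp add: cV_numeral)
    have F: "fps_map abs_V (fps_of_poly
        [:4, - (24 * wp), 60 * (3 * wp^2 - g2), - (900 * wp^3) + 225 * g2 * wp + 225 * g3:]) = F"
      unfolding F_def fps_map_abs_V_pCons fps_of_poly_0 absf.h_0
        cf.h_diff cf.h_add cf.h_minus cf.h_mult cf.h_power cf.h_numeral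
      by algebra
    have R: "fps_map abs_V (fps_of_poly (reflect_poly P))
        = 16 - 504 * cf g2 * fps_X^2 + 2376 * cf g3 * fps_X^3 + 4185 * cf g2^2 * fps_X^4
          - 36450 * cf g2 * cf g3 * fps_X^5 + (- 3375 * cf g2^3 + 91125 * cf g3^2) * fps_X^6"
      unfolding rP fps_map_abs_V_pCons fps_of_poly_0 absf.h_0
        cf.h_diff cf.h_add cf.h_minus cf.h_mult cf.h_power cf.h_numeral cf.h_0
      by algebra
    show "ricc.ric 3 (fps_map abs_V (fps_of_poly
        [:4, - (24 * wp), 60 * (3 * wp^2 - g2), - (900 * wp^3) + 225 * g2 * wp + 225 * g3:]))
      = - 4 * fps_map abs_V (fps_of_poly (reflect_poly P))"
      unfolding F R
    proof (subst ric_even)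
      show "fps_map DV F = cf wp' * (- 24 * fps_X + 360 * cf wp * fps_X^2
          + (- 2700 * cf wp^2 + 225 * cf g2) * fps_X^3)"
        unfolding F_def power2_eq_square power3_eq_cube ricc.df.D_diff ricc.df.D_add
          ricc.df.D_minus ricc.df.D_mult fps_map_DV_cf_basic ricc.df.D_numeral by algebra
      show "fps_map DV (- 24 * fps_X + 360 * cf wp * fps_X^2
          + (- 2700 * cf wp^2 + 225 * cf g2) * fps_X^3)
          = cf wp' * (360 * fps_X^2 - 5400 * cf wp * fps_X^3)"
        unfolding power2_eq_square power3_eq_cube ricc.df.D_diff ricc.df.D_add
          ricc.df.D_minus ricc.df.D_mult fps_map_DV_cf_basic ricc.df.D_numeral by algebra
    qed (simp add: F_def, algebra)
  qed
qed

theorem theorem1p13: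
  fixes p :: nat
  shows "(\<exists>b. b_eq p b) \<and>
    (\<forall>b. b_eq p b \<longrightarrow>
      (let F = rsqrt (map_poly emb1 (Sp p)) * b in
         veq (F $ 0) 1 \<and> (\<forall>n>p. veq (F $ n) 0) \<and>
         (\<exists>A :: nat \<Rightarrow> complex poly poly poly.
             (\<forall>n\<le>p. veq (F $ n) [:A n:] \<and> degree (A n) \<le> p) \<and> (\<exists>n\<le>p. degree (A n) = p)))
      \<and> (p = 1 \<longrightarrow>
           fveq (b * rsqrt (4 * lam^3 - cst g2 * lam - cst g3))
                (fps_const 2 * fps_of_poly (reflect_poly (lam - cst wp))))
      \<and> (p = 2 \<longrightarrow>
           fveq (b * rsqrt ((lam^2 - cst (3 * g2)) * (4 * lam^3 - cst (9 * g2) * lam + cst (27 * g3))))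
                (fps_const (cV (1/2)) * fps_of_poly (reflect_poly
                   (4 * lam^2 - cst (12 * wp) * lam + cst (36 * wp^2 - 9 * g2)))))
      \<and> (p = 3 \<longrightarrow>
           fveq (b * rsqrt (16 * lam^6 - cst (504 * g2) * lam^4 + cst (2376 * g3) * lam^3
                   + cst (4185 * g2^2) * lam^2 - cst (36450 * g2 * g3) * lam
                   - cst (3375 * g2^3) + cst (91125 * g3^2)))
                (fps_of_poly (reflect_poly
                   (4 * lam^3 - cst (24 * wp) * lam^2 + cst (60 * (3 * wp^2 - g2)) * lam
                    - cst (900 * wp^3) + cst (225 * g2 * wp) + cst (225 * g3))))))"
proof -
  obtain a f where ex: "\<exists>b. b_eq p b"
    and F: "\<And>b. b_eq p b \<Longrightarrow>
       fps_map abs_V (rsqrt (map_poly emb1 (Sp p)) * b) = fps_of_poly (reflect_poly a)"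
    and a: "degree a = p" "lead_coeff a = 1" "\<forall>k. coeff a k = iota (f k)"
    "\<forall>k n. n + k > p \<longrightarrow> coeff (f k) n = 0" "coeff (f 0) p \<noteq> 0"
    using b_general[of p] by metis
  have main: "let F = rsqrt (map_poly emb1 (Sp p)) * b in
         veq (F $ 0) 1 \<and> (\<forall>n>p. veq (F $ n) 0) \<and>
         (\<exists>A :: nat \<Rightarrow> complex poly poly poly.
             (\<forall>n\<le>p. veq (F $ n) [:A n:] \<and> degree (A n) \<le> p) \<and> (\<exists>n\<le>p. degree (A n) = p))"
    if "b_eq p b" for b
  proof -
    define G where "G = rsqrt (map_poly emb1 (Sp p)) * b"
    \<comment> \<open>Since \<open>\<surd>(S/\<lambda>)\<close> is \<open>\<lambda>^p\<close> times
      the series \<open>rsqrt\<close>, \<open>G $ n\<close> is the coefficient of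
      \<open>\<lambda>^(p-n)\<close>.\<close>
    have G: "abs_V (G $ n) = (if n > p then 0 else coeff a (p - n))" for n
      using arg_cong[OF F[OF that], of "\<lambda>g. g $ n"] a(1)
      by (simp add: G_def[symmetric] coeff_reflect_poly)
    have deg: "degree (f k) \<le> p" for k
      using a(4) by (intro degree_le) auto
    hence "degree (f 0) = p" by (rule antisym) (rule le_degree, rule a(5))
    \<comment> \<open>Full degree p in \<wp> is reached by the coefficient of
      \<open>\<lambda>^0\<close>, that is at n = p.\<close>
    hence "\<exists>n\<le>p. degree (f (p - n)) = p" by (intro exI[of _ p]) simp
    moreover have "\<forall>n\<le>p. veq (G $ n) [:f (p - n):] \<and> degree (f (p - n)) \<le> p"
      using a(3) deg by (simp add: veq_iff G iota_def)
    moreover have "veq (G $ 0) 1" "\<forall>n>p. veq (G $ n) 0"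
      using a(1,2) by (simp_all add: veq_iff G)
    ultimately show ?thesis
      unfolding G_def[symmetric] Let_def by (intro conjI exI[of _ "\<lambda>n. f (p - n)"])
  qed
  show ?thesis
    using ex main b_closed_form_1 b_closed_form_2 b_closed_form_3 by blast
qed

end
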